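(* Let $v_0,p_1,p_2,p_3\in\mathbb{S}^2$, and suppose that the three oriented geodesic spherical triangles $[v_0,p_1,p_2]_{\mathbb{S}^2}$, $[v_0,p_2,p_3]_{\mathbb{S}^2}$ and $[v_0,p_3,p_1]_{\mathbb{S}^2}$ form the radial projection of a degree-3 vertex star. Put $p_4=p_1$ and let $$\alpha:=\sum_{i=1}^3\operatorname{area}\bigl([v_0,p_i,p_{i+1}]_{\mathbb{S}^2}\bigr).$$ Then $$\sum_{i=1}^3\operatorname{vol}\bigl([o,v_0,p_i,p_{i+1}]\bigr)\le\frac{\sqrt3}{4}\left[1-\frac13\tan^2\left(\frac{2\pi-\alpha}{6}\right)\right].$$ Equality occurs for the rotationally symmetric configuration in which $p_1,p_2,p_3$ have equal spherical distance from $v_0$ and are separated by azimuthal angles $2\pi/3$ around $v_0$.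
   Context: $\mathbb{S}^2$ is the unit sphere in $\mathbb{R}^3$, $o$ is the origin, and $[z_1,\dots,z_k]$ denotes the convex hull of the points $z_1,\dots,z_k$. $\operatorname{vol}$ is 3-dimensional volume and $\operatorname{area}$ of a spherical region is its surface area on $\mathbb{S}^2$. $[a,b,c]_{\mathbb{S}^2}$ denotes the geodesic spherical triangle with vertices $a,b,c$. $R(x)=x/\|x\|$ is the radial projection onto $\mathbb{S}^2$. The star of a vertex $v$ of a polytope is the union of all facets containing $v$. The phrase "form the radial projection of a degree-3 vertex star" means: there is a convex simplicial 3-polytope $P$ with all vertices on $\mathbb{S}^2$ and $o\in\operatorname{int}(P)$ which has $v_0$ as a vertex of degree 3, whose neighbors in cyclic order are $p_1,p_2,p_3$, so that the three facets of $P$ at $v_0$ are $[v_0,p_1,p_2]$, $[v_0,p_2,p_3]$, $[v_0,p_3,p_1]$ and the three spherical triangles are their images under $R$. *)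

theory Defs
  imports "HOL-Analysis.Analysis"
begin

text \<open>
  The point of the unit sphere at polar angle \<open>\<theta>\<close> from the pole \<open>n\<close> and at azimuth
  \<open>\<phi>\<close> around \<open>n\<close>, measured from \<open>u\<close> towards \<open>w\<close>, where \<open>u\<close>, \<open>w\<close>, \<open>n\<close> are orthonormal.
\<close>

definition spherical_point ::
    "real^3 \<Rightarrow> real^3 \<Rightarrow> real^3 \<Rightarrow> real \<Rightarrow> real \<Rightarrow> real^3" where
  "spherical_point n u w \<theta> \<phi> =
     (sin \<theta> * cos \<phi>) *\<^sub>R u + (sin \<theta> * sin \<phi>) *\<^sub>R w + cos \<theta> *\<^sub>R n"

text \<open>
  Surface area on the unit sphere, as the surface integral in the standard spherical
  coordinates \<open>(\<theta>, \<phi>)\<close>; \<open>sin \<theta>\<close> is the norm of the cross product of the two partial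
  derivatives of the parametrization.
\<close>

definition sphere_area :: "(real^3) set \<Rightarrow> real" where
  "sphere_area A =
     set_lebesgue_integral lborel ({0..pi} \<times> {0..<2 * pi})
       (\<lambda>(\<theta>, \<phi>).
          indicator A (spherical_point (axis 3 1) (axis 1 1) (axis 2 1) \<theta> \<phi>) * sin \<theta>)"

text \<open>
  The radial projection \<open>x \<mapsto> x / \<parallel>x\<parallel>\<close> is the library function \<^const>\<open>sgn\<close>.
\<close>

definition spherical_triangle :: "real^3 \<Rightarrow> real^3 \<Rightarrow> real^3 \<Rightarrow> (real^3) set" where
  "spherical_triangle a b c = sgn ` (convex hull {a, b, c})"

definition simplicial_polytope3 :: "(real^3) set \<Rightarrow> bool" where
  "simplicial_polytope3 P \<longleftrightarrow>
     polytope P \<and> aff_dim P = 3 \<and> (\<forall>F. F facet_of P \<longrightarrow> 2 simplex F)"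

definition polytope_neighbors :: "(real^3) set \<Rightarrow> real^3 \<Rightarrow> (real^3) set" where
  "polytope_neighbors P v = {w. closed_segment v w edge_of P}"

definition vertex_degree :: "(real^3) set \<Rightarrow> real^3 \<Rightarrow> nat" where
  "vertex_degree P v = card {e. e edge_of P \<and> v \<in> e}"

definition degree3_star :: "real^3 \<Rightarrow> (nat \<Rightarrow> real^3) \<Rightarrow> bool" where
  "degree3_star v p \<longleftrightarrow>
     (\<exists>P. simplicial_polytope3 P
        \<and> (\<forall>x. x extreme_point_of P \<longrightarrow> x \<in> sphere 0 1)
        \<and> 0 \<in> interior P
        \<and> v extreme_point_of P
        \<and> vertex_degree P v = 3
        \<and> polytope_neighbors P v = {p 1, p 2, p 3}
        \<and> {F. F facet_of P \<and> v \<in> F} =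
            {convex hull {v, p 1, p 2}, convex hull {v, p 2, p 3}, convex hull {v, p 3, p 1}})"

text \<open>
  The azimuths around \<open>v\<close> are \<open>2\<pi>/3\<close>, \<open>4\<pi>/3\<close>, \<open>2\<pi>\<close>; a common offset, and the sense of
  rotation, are absorbed in the choice of the frame \<open>u\<close>, \<open>w\<close>. The bounds on \<open>\<theta>\<close> keep the
  points off the poles \<open>v\<close> and \<open>-v\<close>, where the azimuth is undefined.
\<close>

definition rotationally_symmetric :: "real^3 \<Rightarrow> (nat \<Rightarrow> real^3) \<Rightarrow> bool" where
  "rotationally_symmetric v p \<longleftrightarrow>
     (\<exists>\<theta> u w. 0 < \<theta> \<and> \<theta> < pi
        \<and> norm u = 1 \<and> norm w = 1 \<and> u \<bullet> w = 0 \<and> v \<bullet> u = 0 \<and> v \<bullet> w = 0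
        \<and> (\<forall>i\<in>{1..3}. p i = spherical_point v u w \<theta> (real i * (2 * pi / 3))))"

end

theory Submission
  imports Defs
begin

text \<open>
  Cut the star along the azimuths of \<open>p\<^sub>1, p\<^sub>2, p\<^sub>3\<close> around \<open>v\<^sub>0\<close>. A wedge with azimuth gap \<open>C\<close> and legs
  \<open>\<rho>\<^sub>0, \<rho>\<^sub>1\<close> has volume \<open>sin \<rho>\<^sub>0 sin \<rho>\<^sub>1 sin C / 6\<close> and area \<open>C - 2\<delta>\<close>, where
  \<open>tan \<delta> = r tan (C/2)\<close> with \<open>r = sin (\<rho>\<^sub>0 + \<rho>\<^sub>1) / (sin \<rho>\<^sub>0 + sin \<rho>\<^sub>1)\<close> (one of Napier's analogies).
  Since \<open>sin \<rho>\<^sub>0 sin \<rho>\<^sub>1 \<le> 1 - r\<^sup>2\<close>, the volume is at most a function of \<open>(C/2, \<delta>)\<close> alone, with equality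
  for \<open>\<rho>\<^sub>0 = \<rho>\<^sub>1\<close>. This function turns out to be jointly concave, and Jensen's inequality under
  \<open>\<Sum>C\<^sub>i = 2\<pi>\<close> and \<open>\<Sum>\<delta>\<^sub>i = (2\<pi> - \<alpha>)/2\<close> is the claim. In the symmetric configuration all the
  inequalities are equalities, and the polytope is the bipyramid with apices \<open>\<plusminus>v\<^sub>0\<close>.
\<close>

section \<open>Joint concavity of the volume bound\<close>

text \<open>Jensen needs a bound that is jointly concave in quantities linear in gap and area, since
  these enter the claim only through their sums; this is why the wedge is described by C/2 and
  \<delta>. Geometrically \<delta> is half of pi minus the sum of the two base angles, so C - 2
  \<delta> is Girard's formula, and \<delta> may be negative. The Hessian form changes sign with cot
  (C/2), so concavity depends on C < pi. This shapes the second half: the hypothesis on the star is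
  combinatorial, and what has to be extracted from it is that the azimuths make exactly one turn
  with every gap below pi. Another obstacle is that \<open>sphere_area\<close> is an integral in one
  fixed coordinate system, while the wedge computation wants its pole at the vertex of the star.
  Invariance under rotations is obtained by recognising area as three times the volume of a cone.
  The constants belong to the mean half gap pi/3: sqrt 3 / 4 is 3 * sin (2 * pi / 3) / 6, and 1/3 is
  the square of cot (pi / 3).\<close>

definition wedge_bound :: "real \<Rightarrow> real \<Rightarrow> real" where
  "wedge_bound c d = sin (2 * c) * (1 - (cot c * tan d)\<^sup>2)"

lemma one_plus_cot_squared:
  fixes c :: real
  assumes "sin c \<noteq> 0"
  shows "1 + (cot c)\<^sup>2 = inverse ((sin c)\<^sup>2)"
  using assms sin_cos_squared_add[of c] by (simp add: cot_def field_simps)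

lemma sin_double_cot:
  fixes c :: real
  assumes "sin c \<noteq> 0"
  shows "sin (2 * c) = 2 * cot c / (1 + (cot c)\<^sup>2)"
  unfolding one_plus_cot_squared[OF assms]
  using assms by (simp add: cot_def sin_double power2_eq_square divide_inverse)

text \<open>
  With \<open>x = cot c\<close> and \<open>t = tan d\<close> this is \<open>-(1 + x\<^sup>2) / (4 x)\<close> times the Hessian form of \<^const>\<open>wedge_bound\<close>
  at \<open>(c, d)\<close> in direction \<open>(a, b)\<close>.
\<close>

lemma wedge_hessian_nonneg:
  fixes x t a b :: real
  shows "0 \<le> (2 + (3 + 2 * x\<^sup>2 + x^4) * t\<^sup>2) * a\<^sup>2 - 2 * x * (3 + x\<^sup>2) * t * (1 + t\<^sup>2) * a * b
               + x\<^sup>2 * (1 + t\<^sup>2) * (1 + 3 * t\<^sup>2) * b\<^sup>2" (is "0 \<le> ?Q")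
proof -
  have pos: "1 + 3 * t\<^sup>2 > 0" by (simp add: add_pos_nonneg)
  \<comment> \<open>Completing the square in \<open>b\<close>; the factor 1 + 3 t^2 clears the only
    denominator that arises, so x = 0 and t = 0 need no separate treatment.\<close>
  have "(1 + 3 * t\<^sup>2) * ?Q = (1 + t\<^sup>2) * (x * (1 + 3 * t\<^sup>2) * b - (3 + x\<^sup>2) * t * a)\<^sup>2
          + 2 * (1 - x\<^sup>2 * t\<^sup>2)\<^sup>2 * a\<^sup>2"
    by algebra
  also have "\<dots> \<ge> 0" by simp
  finally show ?thesis using pos by (simp add: zero_le_mult_iff)
qed

text \<open>Along a segment, \<open>X\<close> = cot c and \<open>T\<close> = tan d satisfy X' = -a
  (1 + X^2) and T' = b (1 + T^2). By \<open>sin_double_cot\<close> the bound is a rational function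
  of them, so its two derivatives are verified as polynomial identities.\<close>

lemma wedge_bound_line_concave:
  fixes c0 d0 a b :: real
  assumes c: "\<And>s. s \<in> {0..1} \<Longrightarrow> 0 < c0 + s * a \<and> c0 + s * a < pi / 2"
      and d: "\<And>s. s \<in> {0..1} \<Longrightarrow> - (pi / 2) < d0 + s * b \<and> d0 + s * b < pi / 2"
  shows "concave_on {0..1} (\<lambda>s. wedge_bound (c0 + s * a) (d0 + s * b))"
proof -
  define X where "X = (\<lambda>s. cot (c0 + s * a))"
  define T where "T = (\<lambda>s. tan (d0 + s * b))"
  have sn: "sin (c0 + s * a) > 0" if "s \<in> {0..1}" for s
    using c[OF that] by (intro sin_gt_zero) auto
  have cs: "cos (d0 + s * b) > 0" if "s \<in> {0..1}" for s
    using d[OF that] by (intro cos_gt_zero_pi) auto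
  have Xpos: "X s > 0" if "s \<in> {0..1}" for s
    using c[OF that] by (auto simp: X_def intro!: cot_gt_zero)
  have dX: "(X has_real_derivative - a * (1 + (X s)\<^sup>2)) (at s)" if "s \<in> {0..1}" for s
  proof -
    have "((\<lambda>s. cot (c0 + s * a)) has_real_derivative - inverse ((sin (c0 + s * a))\<^sup>2) * a) (at s)"
      using sn[OF that] by (intro DERIV_chain2[where f = cot] DERIV_cot) (auto intro!: derivative_eq_intros)
    then show ?thesis
      using sn[OF that] by (simp add: X_def one_plus_cot_squared mult.commute)
  qed
  have dT: "(T has_real_derivative b * (1 + (T s)\<^sup>2)) (at s)" if "s \<in> {0..1}" for s
  proof -
    have "((\<lambda>s. tan (d0 + s * b)) has_real_derivative inverse ((cos (d0 + s * b))\<^sup>2) * b) (at s)"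
      using cs[OF that] by (intro DERIV_chain2[where f = tan] DERIV_tan) (auto intro!: derivative_eq_intros)
    then show ?thesis
      using cs[OF that] tan_sec[of "d0 + s * b"] by (simp add: T_def mult.commute power_inverse)
  qed
  have nz: "1 + (X s)\<^sup>2 \<noteq> 0" for s by (simp add: sum_power2_eq_zero_iff[of 1 "X s", simplified])
  define g where "g = (\<lambda>s. 2 * X s * (1 - (X s)\<^sup>2 * (T s)\<^sup>2) / (1 + (X s)\<^sup>2))"
  define g1 where "g1 = (\<lambda>s. (2 * a * (T s)\<^sup>2 * (X s)\<^sup>2 * (3 + (X s)\<^sup>2) - 2 * a * (1 - (X s)\<^sup>2)
            - 4 * b * (X s)^3 * T s * (1 + (T s)\<^sup>2)) / (1 + (X s)\<^sup>2))"
  define Q where "Q = (\<lambda>s. (2 + (3 + 2 * (X s)\<^sup>2 + (X s)^4) * (T s)\<^sup>2) * a\<^sup>2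
               - 2 * X s * (3 + (X s)\<^sup>2) * T s * (1 + (T s)\<^sup>2) * a * b
               + (X s)\<^sup>2 * (1 + (T s)\<^sup>2) * (1 + 3 * (T s)\<^sup>2) * b\<^sup>2)"
  \<comment> \<open>The second derivative, factored so that its sign can be read off:
    \<open>Q\<close> is the nonnegative form, and \<open>X\<close> > 0 because the half gap is below
    pi/2.\<close>
  define g2 where "g2 = (\<lambda>s. - (4 * X s / (1 + (X s)\<^sup>2)) * Q s)"
  have "concave_on {0..1} g"
  proof (rule f''_le0_imp_concave)
    fix s :: real assume s: "s \<in> {0..1}"
    show "(g has_real_derivative g1 s) (at s)"
      unfolding g_def g1_def
      apply (rule derivative_eq_intros dX[OF s] dT[OF s] refl nz)+
      using nz[of s] by (simp add: divide_simps) algebra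
    show "(g1 has_real_derivative g2 s) (at s)"
      unfolding g1_def g2_def Q_def
      apply (rule derivative_eq_intros dX[OF s] dT[OF s] refl nz)+
      using nz[of s] by (simp add: divide_simps) algebra
    have "Q s \<ge> 0" unfolding Q_def by (rule wedge_hessian_nonneg)
    moreover have "4 * X s / (1 + (X s)\<^sup>2) \<ge> 0" using Xpos[OF s] by simp
    ultimately show "g2 s \<le> 0" unfolding g2_def by (metis minus_mult_left mult_nonneg_nonneg neg_le_0_iff_le)
  qed auto
  moreover have "wedge_bound (c0 + s * a) (d0 + s * b) = g s" if "s \<in> {0..1}" for s
    using sin_double_cot[of "c0 + s * a"] sn[OF that]
    by (simp add: wedge_bound_def g_def X_def T_def power_mult_distrib)
  ultimately show ?thesis
    unfolding concave_on_def convex_on_def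
    by (smt (verit, best) convex_alt real_scaleR_def)
qed

text \<open>Joint concavity is concavity along every segment of the convex domain.\<close>

lemma wedge_bound_concave:
  "concave_on ({0<..<pi/2} \<times> {-(pi/2)<..<pi/2}) (\<lambda>z. wedge_bound (fst z) (snd z))"
proof -
  have conv: "convex ({0<..<pi/2} \<times> {-(pi/2)<..<pi/2::real})"
    by (intro convex_Times convex_real_interval)
  show ?thesis
    unfolding concave_on_iff
  proof (intro conjI ballI allI impI conv)
    fix z z' :: "real \<times> real" and u v :: real
    assume z: "z \<in> {0<..<pi/2} \<times> {-(pi/2)<..<pi/2}" "z' \<in> {0<..<pi/2} \<times> {-(pi/2)<..<pi/2}"
       and uv: "0 \<le> u" "0 \<le> v" "u + v = 1"
    obtain c d c' d' where eq: "z = (c, d)" "z' = (c', d')"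
      by fastforce
    have in_dom: "(c + s * (c' - c), d + s * (d' - d)) \<in> {0<..<pi/2} \<times> {-(pi/2)<..<pi/2}"
      if "s \<in> {0..1}" for s
      using convexD[OF conv z, of "1 - s" s] that by (simp add: eq algebra_simps)
    have "concave_on {0..1} (\<lambda>s. wedge_bound (c + s * (c' - c)) (d + s * (d' - d)))"
      using in_dom by (intro wedge_bound_line_concave) auto
    from this[unfolded concave_on_iff, THEN conjunct2, rule_format, of 0 1 u v] uv
    have "u * wedge_bound c d + v * wedge_bound c' d' \<le> wedge_bound (c + v * (c' - c)) (d + v * (d' - d))"
      by simp
    moreover have "c + v * (c' - c) = u * c + v * c'" "d + v * (d' - d) = u * d + v * d'"
      using uv(3) by (auto simp: algebra_simps) (metis distrib_left mult.commute mult_1)+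
    ultimately show "u * wedge_bound (fst z) (snd z) + v * wedge_bound (fst z') (snd z')
        \<le> wedge_bound (fst (u *\<^sub>R z + v *\<^sub>R z')) (snd (u *\<^sub>R z + v *\<^sub>R z'))"
      by (simp add: eq)
  qed
qed

text \<open>Jensen with weights 1/3. The mean of the \<open>c i\<close> is pi/3, where sin (2 c) =
  sqrt 3 / 2 and cot^2 c = 1/3.\<close>

lemma wedge_bound_sum_le:
  fixes c d :: "nat \<Rightarrow> real"
  assumes "\<And>i. i \<in> {1..3} \<Longrightarrow> 0 < c i \<and> c i < pi / 2"
    and "\<And>i. i \<in> {1..3} \<Longrightarrow> - (pi / 2) < d i \<and> d i < pi / 2"
    and sum_c: "(\<Sum>i=1..3. c i) = pi"
  shows "(\<Sum>i=1..3. wedge_bound (c i) (d i)) \<le> 3 * sqrt 3 / 2 * (1 - 1 / 3 * (tan ((\<Sum>i=1..3. d i) / 3))\<^sup>2)"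
proof -
  have "(\<Sum>i\<in>{1..3::nat}. (1/3) * (\<lambda>z. wedge_bound (fst z) (snd z)) (c i, d i))
      \<le> (\<lambda>z. wedge_bound (fst z) (snd z)) (\<Sum>i\<in>{1..3::nat}. (1/3) *\<^sub>R (c i, d i))"
    by (rule concave_on_sum[OF _ _ wedge_bound_concave]) (use assms in \<open>auto simp: greaterThanLessThan_iff\<close>)
  also have "(\<Sum>i\<in>{1..3::nat}. (1/3) *\<^sub>R (c i, d i)) = (pi / 3, (\<Sum>i=1..3. d i) / 3)"
    using sum_c by (simp add: prod_eq_iff fst_sum snd_sum flip: sum_divide_distrib)
  finally have "(\<Sum>i=1..3. wedge_bound (c i) (d i)) \<le> 3 * wedge_bound (pi / 3) ((\<Sum>i=1..3. d i) / 3)"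
    by (simp flip: sum_divide_distrib)
  also have "wedge_bound (pi / 3) x = sqrt 3 / 2 * (1 - 1 / 3 * (tan x)\<^sup>2)" for x
    using sin_120 by (simp add: wedge_bound_def cot_def sin_60 cos_60 power_mult_distrib power_divide)
  finally show ?thesis by simp
qed

section \<open>Spherical area as the volume of a cone\<close>

lemma axis_component: "axis i x $ j = (if j = i then x else 0)"
  by (simp add: axis_def)

definition vec3 :: "real \<times> real \<times> real \<Rightarrow> real^3" where
  "vec3 z = fst z *\<^sub>R axis 1 1 + fst (snd z) *\<^sub>R axis 2 1 + snd (snd z) *\<^sub>R axis 3 1"

lemma vec3_nth [simp]:
  "vec3 z $ 1 = fst z" "vec3 z $ 2 = fst (snd z)" "vec3 z $ 3 = snd (snd z)"
  by (simp_all add: vec3_def axis_component)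

lemma vec3_measurable [measurable]: "vec3 \<in> borel \<rightarrow>\<^sub>M borel"
  unfolding vec3_def by (intro borel_measurable_continuous_onI continuous_intros)

text \<open>Boxes determine \<open>lborel\<close>, and a box has the same volume in both
  descriptions. This makes Tonelli's theorem on nested pairs available for integrals over
  vectors.\<close>

lemma lborel_vec3: "lborel = distr lborel borel vec3"
proof (rule lborel_eqI)
  fix l u :: "real^3"
  assume le: "\<And>b. b \<in> Basis \<Longrightarrow> l \<bullet> b \<le> u \<bullet> b"
  have le': "l $ i \<le> u $ i" for i
    using le[of "axis i 1"] by (simp add: axis_in_Basis_iff inner_axis)
  have "vec3 -` box l u = {l $ 1<..<u $ 1} \<times> {l $ 2<..<u $ 2} \<times> {l $ 3<..<u $ 3}"
    by (auto simp: mem_box_cart forall_3)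
  then have "emeasure (distr lborel borel vec3) (box l u)
      = emeasure lborel ({l $ 1<..<u $ 1} \<times> {l $ 2<..<u $ 2} \<times> {l $ 3<..<u $ 3})"
    by (subst emeasure_distr) auto
  also have "\<dots> = emeasure (lborel \<Otimes>\<^sub>M lborel) ({l $ 1<..<u $ 1} \<times> {l $ 2<..<u $ 2} \<times> {l $ 3<..<u $ 3})"
    by (simp only: lborel_prod)
  also have "\<dots> = emeasure lborel {l $ 1<..<u $ 1} * emeasure lborel ({l $ 2<..<u $ 2} \<times> {l $ 3<..<u $ 3})"
    by (rule lborel.emeasure_pair_measure_Times) (auto intro!: borel_open open_Times)
  also have "emeasure lborel ({l $ 2<..<u $ 2} \<times> {l $ 3<..<u $ 3})
      = emeasure (lborel \<Otimes>\<^sub>M lborel) ({l $ 2<..<u $ 2} \<times> {l $ 3<..<u $ 3})"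
    by (simp only: lborel_prod)
  also have "\<dots> = emeasure lborel {l $ 2<..<u $ 2} * emeasure lborel {l $ 3<..<u $ 3}"
    by (rule lborel.emeasure_pair_measure_Times) auto
  also have "emeasure lborel {l $ 1<..<u $ 1} * (emeasure lborel {l $ 2<..<u $ 2} * emeasure lborel {l $ 3<..<u $ 3})
     = ennreal (\<Prod>i\<in>UNIV. (u - l) $ i)"
    using le' unfolding UNIV_3 by (simp add: ennreal_mult mult.assoc)
  also have "(\<Prod>i\<in>UNIV. (u - l) $ i) = (\<Prod>b\<in>Basis. (u - l) \<bullet> b)"
  proof -
    have B: "Basis = (\<lambda>i. axis i 1 :: real^3) ` UNIV"
      by (auto simp: Basis_vec_def)
    have "inj (\<lambda>i. axis i 1 :: real^3)"
      by (simp add: inj_def axis_eq_axis)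
    then show ?thesis
      unfolding B by (subst prod.reindex) (auto simp: inner_axis simp del: vector_minus_component)
  qed
  finally show "emeasure (distr lborel borel vec3) (box l u) = (\<Prod>b\<in>Basis. (u - l) \<bullet> b)" .
qed simp

section \<open>Spherical coordinates and their Jacobian\<close>

abbreviation sp3 :: "real \<Rightarrow> real \<Rightarrow> real^3" where
  "sp3 \<equiv> spherical_point (axis 3 1) (axis 1 1) (axis 2 1)"

lemma sp3_nth [simp]:
  "sp3 \<theta> \<phi> $ 1 = sin \<theta> * cos \<phi>" "sp3 \<theta> \<phi> $ 2 = sin \<theta> * sin \<phi>" "sp3 \<theta> \<phi> $ 3 = cos \<theta>"
  by (simp_all add: spherical_point_def axis_component)

lemma norm_sp3 [simp]: "norm (sp3 \<theta> \<phi>) = 1"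
proof -
  have "(sin \<theta> * cos \<phi>)\<^sup>2 + (sin \<theta> * sin \<phi>)\<^sup>2 + (cos \<theta>)\<^sup>2 = 1"
    using sin_cos_squared_add[of \<theta>] sin_cos_squared_add[of \<phi>] by algebra
  then show ?thesis by (simp add: norm_vec_def L2_set_def sum_3)
qed

lemma sp3_nonzero [simp]: "sp3 \<theta> \<phi> \<noteq> 0"
  by (metis norm_sp3 norm_zero zero_neq_one)

definition spherical_map :: "real^3 \<Rightarrow> real^3" where
  "spherical_map y = y $ 1 *\<^sub>R sp3 (y $ 2) (y $ 3)"

text \<open>The three summands are the radial, polar and azimuthal partial derivatives, each times
  its component of \<open>h\<close>.\<close>

definition spherical_map' :: "real^3 \<Rightarrow> real^3 \<Rightarrow> real^3" where
  "spherical_map' y h = h $ 1 *\<^sub>R sp3 (y $ 2) (y $ 3)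
     + (y $ 1 * h $ 2) *\<^sub>R ((cos (y $ 2) * cos (y $ 3)) *\<^sub>R axis 1 1 + (cos (y $ 2) * sin (y $ 3)) *\<^sub>R axis 2 1 - sin (y $ 2) *\<^sub>R axis 3 1)
     + (y $ 1 * h $ 3) *\<^sub>R (- (sin (y $ 2) * sin (y $ 3)) *\<^sub>R axis 1 1 + (sin (y $ 2) * cos (y $ 3)) *\<^sub>R axis 2 1)"

lemma has_derivative_vec_nth: "((\<lambda>y::real^'n. y $ i) has_derivative (\<lambda>h. h $ i)) F"
  by (rule bounded_linear_imp_has_derivative[OF bounded_linear_vec_nth])

lemma spherical_map_has_derivative:
  "(spherical_map has_derivative spherical_map' y) (at y within S)"
  unfolding spherical_map_def spherical_point_def
  apply (rule has_derivative_eq_rhs)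
   apply (rule derivative_intros has_derivative_vec_nth)+
  unfolding spherical_map'_def spherical_point_def
  by (simp add: fun_eq_iff vec_eq_iff forall_3 spherical_map'_def axis_component algebra_simps)

lemma det_spherical_map': "det (matrix (spherical_map' y)) = (y $ 1)\<^sup>2 * sin (y $ 2)"
proof -
  have "(sin (y $ 2))\<^sup>2 + (cos (y $ 2))\<^sup>2 = 1" "(sin (y $ 3))\<^sup>2 + (cos (y $ 3))\<^sup>2 = 1"
    by simp_all
  \<comment> \<open>Multiplied out, the left side is the expanded determinant. The Pythagorean simp
    rules are switched off below so that it stays in this form.\<close>
  then have "y $ 1 * y $ 1 * sin (y $ 2) * ((sin (y $ 2))\<^sup>2 + (cos (y $ 2))\<^sup>2)
      * ((sin (y $ 3))\<^sup>2 + (cos (y $ 3))\<^sup>2) = (y $ 1)\<^sup>2 * sin (y $ 2)"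
    by (simp add: power2_eq_square)
  then show ?thesis
    unfolding det_3
    by (simp add: matrix_def spherical_map'_def spherical_point_def axis_component algebra_simps power2_eq_square
             del: sin_cos_squared_add sin_cos_squared_add2 sin_cos_squared_add3)
qed

text \<open>The origin and both poles are left out and the azimuth is half-open, which makes
  \<open>spherical_map\<close> injective here; what is lost is a null set.\<close>

definition polar_box :: "(real^3) set" where
  "polar_box = {y. 0 < y $ 1 \<and> y $ 1 \<le> 1 \<and> 0 < y $ 2 \<and> y $ 2 < pi \<and> 0 \<le> y $ 3 \<and> y $ 3 < 2 * pi}"

lemma norm_spherical_map [simp]: "norm (spherical_map y) = \<bar>y $ 1\<bar>"
  by (simp add: spherical_map_def)

lemma inj_on_spherical_map: "inj_on spherical_map polar_box"
proof (rule inj_onI)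
  fix y z assume y: "y \<in> polar_box" and z: "z \<in> polar_box" and eq: "spherical_map y = spherical_map z"
  have 1: "y $ 1 = z $ 1"
    using arg_cong[OF eq, of norm] y z by (simp add: polar_box_def)
  have nz: "z $ 1 \<noteq> 0" using z by (simp add: polar_box_def)
  then have eq': "sp3 (y $ 2) (y $ 3) = sp3 (z $ 2) (z $ 3)"
    using eq 1 by (simp add: spherical_map_def)
  have 2: "y $ 2 = z $ 2"
    using arg_cong[OF eq', of "\<lambda>v. v $ 3"] y z by - (rule cos_inj_pi, simp_all add: polar_box_def)
  have "sin (z $ 2) \<noteq> 0"
    using z sin_gt_zero[of "z $ 2"] by (auto simp: polar_box_def)
  then have "cos (y $ 3) = cos (z $ 3)" "sin (y $ 3) = sin (z $ 3)"
    using arg_cong[OF eq', of "\<lambda>v. v $ 1"] arg_cong[OF eq', of "\<lambda>v. v $ 2"] 2 by auto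
  then obtain n :: int where n: "y $ 3 = z $ 3 + 2 * pi * n"
    using sin_cos_eq_iff by blast
  have "\<bar>2 * pi * n\<bar> < 2 * pi"
    using y z n by (auto simp: polar_box_def)
  then have "\<bar>real_of_int n\<bar> < 1" by (simp add: abs_mult)
  then have "n = 0" by linarith
  then have 3: "y $ 3 = z $ 3" using n by simp
  show "y = z" using 1 2 3 by (simp add: vec_eq_iff forall_3)
qed

lemma spherical_coordinates:
  fixes x :: "real^3"
  assumes "x $ 1 \<noteq> 0 \<or> x $ 2 \<noteq> 0"
  obtains y where "x = spherical_map y" "0 < y $ 1" "y $ 1 = norm x" "0 < y $ 2" "y $ 2 < pi" "0 \<le> y $ 3" "y $ 3 < 2 * pi"
proof -
  define r where "r = norm x"
  have r: "r > 0" using assms by (auto simp: r_def)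
  have sq: "(x $ 1)\<^sup>2 + (x $ 2)\<^sup>2 + (x $ 3)\<^sup>2 = r\<^sup>2"
    by (simp add: r_def norm_vec_def L2_set_def sum_3)
  define \<theta> where "\<theta> = arccos (x $ 3 / r)"
  have "(x $ 1)\<^sup>2 + (x $ 2)\<^sup>2 > 0" using assms by (simp add: sum_power2_gt_zero_iff)
  with sq have "(x $ 3)\<^sup>2 < r\<^sup>2" by linarith
  then have "\<bar>x $ 3\<bar> < r" using r by (metis abs_of_pos abs_le_square_iff not_le)
  then have b: "-1 < x $ 3 / r" "x $ 3 / r < 1" using r by (auto simp: field_simps)
  have \<theta>: "0 < \<theta>" "\<theta> < pi" using arccos_lt_bounded[OF b] by (auto simp: \<theta>_def)
  have c\<theta>: "r * cos \<theta> = x $ 3" using b r by (simp add: \<theta>_def)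
  have s: "sin \<theta> > 0" using \<theta> by (rule sin_gt_zero)
  have rs: "(r * sin \<theta>)\<^sup>2 = (x $ 1)\<^sup>2 + (x $ 2)\<^sup>2"
    using sq c\<theta> sin_cos_squared_add[of \<theta>] by algebra
  have "(x $ 1 / (r * sin \<theta>))\<^sup>2 + (x $ 2 / (r * sin \<theta>))\<^sup>2 = 1"
    unfolding power_divide using rs r s assms
    by (auto simp: sum_power2_eq_zero_iff simp flip: add_divide_distrib)
  then obtain \<phi> where \<phi>: "0 \<le> \<phi>" "\<phi> < 2 * pi" "x $ 1 / (r * sin \<theta>) = cos \<phi>" "x $ 2 / (r * sin \<theta>) = sin \<phi>"
    by (rule sincos_total_2pi)
  have "x = spherical_map (vec3 (r, \<theta>, \<phi>))"
    using \<phi>(3,4) c\<theta> r s by (simp add: spherical_map_def vec_eq_iff forall_3 field_simps)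
  then show thesis
    using that[of "vec3 (r, \<theta>, \<phi>)"] r \<theta> \<phi> by (simp add: r_def)
qed

text \<open>The part of the unit ball above \<open>A\<close>. Its volume is a third of the area of
  \<open>A\<close>, and volume, unlike an integral in fixed coordinates, is visibly invariant under
  rotations.\<close>

definition unit_cone :: "(real^3) set \<Rightarrow> (real^3) set" where
  "unit_cone A = {x. x \<noteq> 0 \<and> norm x \<le> 1 \<and> sgn x \<in> A}"

lemma continuous_on_spherical_point [continuous_intros]:
  fixes f g :: "'a::t2_space \<Rightarrow> real"
  assumes "continuous_on T f" "continuous_on T g"
  shows "continuous_on T (\<lambda>x. spherical_point n u w (f x) (g x))"
  unfolding spherical_point_def by (intro continuous_intros assms)

lemma sets_unit_cone [measurable]:
  assumes [measurable]: "A \<in> sets borel"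
  shows "unit_cone A \<in> sets borel"
proof -
  have [measurable]: "(sgn :: real^3 \<Rightarrow> _) \<in> borel_measurable borel"
    unfolding sgn_div_norm by (intro borel_measurable_scaleR borel_measurable_inverse borel_measurable_norm) auto
  show ?thesis unfolding unit_cone_def by measurable
qed

lemma lmeasurable_unit_cone: "A \<in> sets borel \<Longrightarrow> unit_cone A \<in> lmeasurable"
  by (rule bounded_set_imp_lmeasurable) (auto simp: bounded_iff unit_cone_def)

text \<open>Extension by zero to the whole plane, so that Tonelli applies to the full product
  measure.\<close>

definition area_integrand :: "(real^3) set \<Rightarrow> real \<times> real \<Rightarrow> real" where
  "area_integrand A w =
     indicator ({0..pi} \<times> {0..<2 * pi}) w * (indicator A (sp3 (fst w) (snd w)) * sin (fst w))"

lemma area_integrand_measurable [measurable]: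
  assumes [measurable]: "A \<in> sets borel"
  shows "area_integrand A \<in> borel_measurable borel"
  unfolding area_integrand_def
proof (intro borel_measurable_times)
  have [measurable]: "(\<lambda>w. sp3 (fst w) (snd w)) \<in> borel_measurable borel"
    by (intro borel_measurable_continuous_onI continuous_intros)
  show "(\<lambda>w. indicator A (sp3 (fst w) (snd w)) :: real) \<in> borel_measurable borel"
    by measurable
  show "(\<lambda>w :: real \<times> real. sin (fst w)) \<in> borel_measurable borel"
    by (intro borel_measurable_continuous_onI continuous_intros)
qed (auto intro!: borel_measurable_indicator borel_Times)

lemma sphere_area_eq_nn_integral:
  assumes [measurable]: "A \<in> sets borel"
  shows "sphere_area A = enn2real (\<integral>\<^sup>+ w. ennreal (area_integrand A w) \<partial>lborel)"
proof -
  have "sphere_area A = (LINT w|lborel. area_integrand A w)"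
    by (simp add: area_integrand_def sphere_area_def set_lebesgue_integral_def case_prod_beta)
  also have "\<dots> = enn2real (\<integral>\<^sup>+ w. ennreal (area_integrand A w) \<partial>lborel)"
  proof (rule integral_eq_nn_integral)
    show "AE w in lborel. 0 \<le> area_integrand A w"
      by (auto simp: area_integrand_def indicator_def sin_ge_zero intro!: AE_I2)
  qed auto
  finally show ?thesis .
qed

text \<open>Change of variables with Jacobian r^2 sin \<theta>. The integral factors, and the radial
  factor, the integral of r^2 over [0,1], is 1/3.\<close>

lemma sphere_area_eq_measure_unit_cone:
  assumes A[measurable]: "A \<in> sets borel"
  shows "sphere_area A = 3 * measure lebesgue (unit_cone A)"
proof -
  define S where "S = {y \<in> polar_box. sp3 (y $ 2) (y $ 3) \<in> A}"
  have nthm: "(\<lambda>y::real^3. y $ i) \<in> borel_measurable borel" for i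
    by (intro borel_measurable_continuous_onI continuous_intros)
  have [measurable]: "(\<lambda>y. sp3 (y $ 2) (y $ 3)) \<in> borel_measurable borel"
    by (intro borel_measurable_continuous_onI continuous_intros)
  have Sm[measurable]: "S \<in> sets borel"
  proof -
    note [measurable] = nthm
    show ?thesis unfolding S_def polar_box_def by measurable
  qed
  have Sbox: "S \<subseteq> cbox 0 (vec3 (1, pi, 2 * pi))"
    by (auto simp: S_def polar_box_def mem_box_cart forall_3)
  have pos: "\<bar>det (matrix (spherical_map' y))\<bar> = (y $ 1)\<^sup>2 * sin (y $ 2)" if "y \<in> S" for y
    using that sin_gt_zero[of "y $ 2"] by (auto simp: det_spherical_map' S_def polar_box_def)
  have int: "set_integrable lborel S (\<lambda>y. (y $ 1)\<^sup>2 * sin (y $ 2))"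
    unfolding set_integrable_def
  proof (rule integrableI_bounded_set_indicator[where B = 1])
    show "emeasure lborel S < \<infinity>"
      using emeasure_mono[OF Sbox, of lborel]
      by (intro le_less_trans[OF _ emeasure_lborel_cbox_finite]) auto
    show "(\<lambda>y::real^3. (y $ 1)\<^sup>2 * sin (y $ 2)) \<in> borel_measurable lborel"
      using nthm by measurable
    have "\<bar>(y $ 1)\<^sup>2 * sin (y $ 2)\<bar> \<le> 1" if "y \<in> S" for y
      using that abs_square_le_1[of "y $ 1"] abs_sin_le_one[of "y $ 2"]
      by (auto simp: abs_mult S_def polar_box_def intro!: mult_le_one)
    then show "AE y in lborel. y \<in> S \<longrightarrow> norm ((y $ 1)\<^sup>2 * sin (y $ 2)) \<le> 1"
      by simp
  qed simp
  have int': "(\<lambda>y. \<bar>det (matrix (spherical_map' y))\<bar>) integrable_on S"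
    using set_borel_integral_eq_integral(1)[OF int] by (simp add: pos cong: integrable_cong)
  have "measure lebesgue (spherical_map ` S) = integral S (\<lambda>y. \<bar>det (matrix (spherical_map' y))\<bar>)"
  proof (rule measure_differentiable_image_eq)
    show "inj_on spherical_map S"
      using inj_on_spherical_map by (rule inj_on_subset) (auto simp: S_def)
  qed (use Sm int' in \<open>auto intro: spherical_map_has_derivative\<close>)
  also have "\<dots> = integral S (\<lambda>y. (y $ 1)\<^sup>2 * sin (y $ 2))"
    by (rule integral_cong) (rule pos)
  also have "\<dots> = (LINT y:S|lborel. (y $ 1)\<^sup>2 * sin (y $ 2))"
    using set_borel_integral_eq_integral(2)[OF int] by simp
  also have "\<dots> = enn2real (\<integral>\<^sup>+ y. ennreal (indicator S y * ((y $ 1)\<^sup>2 * sin (y $ 2))) \<partial>lborel)"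
    unfolding set_lebesgue_integral_def real_scaleR_def
  proof (rule integral_eq_nn_integral)
    show "(\<lambda>y. indicator S y * ((y $ 1)\<^sup>2 * sin (y $ 2))) \<in> borel_measurable lborel"
      using nthm by measurable
  qed (use pos in \<open>auto simp: indicator_def simp flip: pos\<close>)
  also have "(\<integral>\<^sup>+ y. ennreal (indicator S y * ((y $ 1)\<^sup>2 * sin (y $ 2))) \<partial>lborel)
     = (\<integral>\<^sup>+ z. ennreal (indicator S (vec3 z) * ((vec3 z $ 1)\<^sup>2 * sin (vec3 z $ 2))) \<partial>lborel)"
    using nthm by (subst lborel_vec3, subst nn_integral_distr) auto
  also have "\<dots> = (\<integral>\<^sup>+ z. ennreal (indicator {0..1} (fst z) * (fst z)\<^sup>2)
       * ennreal (area_integrand A (snd z)) \<partial>(lborel \<Otimes>\<^sub>M lborel))"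
    unfolding lborel_prod
  proof (rule nn_integral_cong)
    fix z :: "real \<times> real \<times> real"
    obtain r \<theta> \<phi> where z: "z = (r, \<theta>, \<phi>)" by (cases z) auto
    \<comment> \<open>\<open>polar_box\<close> omits r = 0 and the poles, which the right side
      includes; the factors r^2 and sin \<theta> vanish there, so the integrands agree
      everywhere.\<close>
    have "sin \<theta> \<ge> 0" if "0 \<le> \<theta>" "\<theta> \<le> pi" using that by (rule sin_ge_zero)
    moreover have "\<theta> = 0 \<or> \<theta> = pi \<or> 0 < \<theta> \<and> \<theta> < pi" if "0 \<le> \<theta>" "\<theta> \<le> pi" using that by auto
    ultimately show "ennreal (indicator S (vec3 z) * ((vec3 z $ 1)\<^sup>2 * sin (vec3 z $ 2))) =
       ennreal (indicator {0..1} (fst z) * (fst z)\<^sup>2)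
       * ennreal (area_integrand A (snd z))"
      by (cases "r = 0") (auto simp: z S_def area_integrand_def polar_box_def indicator_def ennreal_mult)
  qed
  also have "\<dots> = (\<integral>\<^sup>+ r. \<integral>\<^sup>+ w. ennreal (indicator {0..1} r * r\<^sup>2)
       * ennreal (area_integrand A w) \<partial>lborel \<partial>lborel)"
    by (subst lborel.nn_integral_fst[symmetric]) auto
  also have "\<dots> = (\<integral>\<^sup>+ r. ennreal (indicator {0..1} r * r\<^sup>2) \<partial>lborel)
     * (\<integral>\<^sup>+ w. ennreal (area_integrand A w) \<partial>lborel)"
    by (subst nn_integral_cmult) (auto simp: nn_integral_multc)
  also have "(\<integral>\<^sup>+ r. ennreal (indicator {0..1} r * r\<^sup>2) \<partial>lborel) = ennreal (1 / 3)"
  proof -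
    have "(\<integral>\<^sup>+ r. ennreal (indicator {0..1} r * r\<^sup>2) \<partial>lborel) = (\<integral>\<^sup>+ r. ennreal (r\<^sup>2) * indicator {0..1} r \<partial>lborel)"
      by (intro nn_integral_cong) (auto simp: indicator_def)
    also have "\<dots> = ennreal (1^3 / 3 - 0^3 / 3)"
      by (rule nn_integral_FTC_Icc[where F = "\<lambda>r. r^3 / 3"]) (auto intro!: derivative_eq_intros)
    finally show ?thesis by simp
  qed
  also have "enn2real (ennreal (1 / 3) * (\<integral>\<^sup>+ w. ennreal (area_integrand A w) \<partial>lborel)) = 1 / 3 * sphere_area A"
    by (simp add: enn2real_mult sphere_area_eq_nn_integral[OF A])
  finally have image: "sphere_area A = 3 * measure lebesgue (spherical_map ` S)" by simp
  have sub: "spherical_map ` S \<subseteq> unit_cone A"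
  proof clarify
    fix y assume "y \<in> S"
    then show "spherical_map y \<in> unit_cone A"
      by (auto simp: unit_cone_def S_def polar_box_def spherical_map_def sgn_div_norm)
  qed
  \<comment> \<open>Only points of the third axis can be missed; they lie in a coordinate plane,
    which is negligible.\<close>
  have sub': "unit_cone A - spherical_map ` S \<subseteq> {x. x $ 2 = 0}"
  proof (clarify, rule ccontr)
    fix x assume x: "x \<in> unit_cone A" "x \<notin> spherical_map ` S" "x $ 2 \<noteq> 0"
    from spherical_coordinates[OF disjI2[OF x(3)]] obtain y where y: "x = spherical_map y" "0 < y $ 1" "y $ 1 = norm x" "0 < y $ 2" "y $ 2 < pi" "0 \<le> y $ 3" "y $ 3 < 2 * pi"
      by metis
    have "sgn x = sp3 (y $ 2) (y $ 3)"
      unfolding y(1) using y(2) by (simp add: sgn_div_norm spherical_map_def)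
    moreover have "norm x \<le> 1" "sgn x \<in> A" using x(1) by (simp_all add: unit_cone_def)
    ultimately have "y \<in> S" using y(2-) by (simp add: S_def polar_box_def)
    with x(2) y(1) show False by blast
  qed
  have "measure lebesgue (spherical_map ` S) = measure lebesgue (unit_cone A)"
  proof -
    have "unit_cone A \<in> lmeasurable" using A by (rule lmeasurable_unit_cone)
    moreover have "negligible (unit_cone A - spherical_map ` S \<union> (spherical_map ` S - unit_cone A))"
      by (rule negligible_subset[OF negligible_standard_hyperplane_cart[of 2]]) (use sub sub' in auto)
    ultimately show ?thesis
      by (metis measure_negligible_symdiff)
  qed
  with image show ?thesis by simp
qed

section \<open>Spherical triangles with a vertex at the pole\<close>

lemma orthogonal_image_unit_cone:
  assumes "orthogonal_transformation R"
  shows "unit_cone (R ` A) = R ` unit_cone A"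
proof -
  have lin: "linear R" and nrm: "\<And>x. norm (R x) = norm x" and bij: "bij R"
    using assms by (auto simp: orthogonal_transformation_linear orthogonal_transformation_norm orthogonal_transformation_bij)
  have sgnR: "sgn (R x) = R (sgn x)" for x
    by (simp add: sgn_div_norm nrm linear_scale[OF lin])
  show ?thesis
  proof (intro equalityI subsetI)
    fix y assume y: "y \<in> unit_cone (R ` A)"
    obtain x where x: "y = R x" using bij by (metis bij_pointE)
    have "x \<in> unit_cone A"
      using y nrm[of x] bij by (auto simp: unit_cone_def x sgnR linear_0[OF lin] bij_def inj_image_mem_iff)
    then show "y \<in> R ` unit_cone A" using x by blast
  next
    fix y assume "y \<in> R ` unit_cone A"
    then obtain x where x: "y = R x" "x \<in> unit_cone A" by blast
    then show "y \<in> unit_cone (R ` A)"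
      using nrm[of x] by (auto simp: unit_cone_def sgnR)
  qed
qed

text \<open>The gain from passing to cones: an orthogonal map carries \<open>unit_cone A\<close> to
  the cone over the image and preserves its Lebesgue measure.\<close>

lemma sphere_area_orthogonal_image:
  assumes R: "orthogonal_transformation R" and A: "compact A"
  shows "sphere_area (R ` A) = sphere_area A"
proof -
  have "compact (R ` A)"
    using A orthogonal_transformation_linear[OF R]
    by (intro compact_continuous_image linear_continuous_on) (simp_all add: linear_conv_bounded_linear)
  then show ?thesis
    using A by (simp add: sphere_area_eq_measure_unit_cone borel_compact orthogonal_image_unit_cone[OF R]
        measure_orthogonal_image[OF R] lmeasurable_unit_cone)
qed

lemma spherical_triangle_orthogonal_image:
  assumes R: "orthogonal_transformation R"
  shows "spherical_triangle (R a) (R b) (R c) = R ` spherical_triangle a b c"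
proof -
  have lin: "linear R" using R by (rule orthogonal_transformation_linear)
  have "convex hull {R a, R b, R c} = R ` (convex hull {a, b, c})"
    by (simp add: convex_hull_linear_image[OF lin])
  moreover have "sgn (R x) = R (sgn x)" for x
    by (simp add: sgn_div_norm orthogonal_transformation_norm[OF R] linear_scale[OF lin])
  ultimately show ?thesis by (simp add: spherical_triangle_def image_image)
qed

text \<open>Radial projection absorbs the normalisation of convex coefficients, so only their signs
  matter. Conversely the coefficients are divided by their sum, which is nonzero because
  \<open>y\<close> is.\<close>

lemma mem_spherical_triangle_iff:
  assumes "norm y = 1"
  shows "y \<in> spherical_triangle a b c \<longleftrightarrow>
    (\<exists>\<alpha> \<beta> \<gamma>. 0 \<le> \<alpha> \<and> 0 \<le> \<beta> \<and> 0 \<le> \<gamma> \<and> y = \<alpha> *\<^sub>R a + \<beta> *\<^sub>R b + \<gamma> *\<^sub>R c)"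
proof
  assume "y \<in> spherical_triangle a b c"
  then obtain \<alpha> \<beta> \<gamma> where *: "0 \<le> \<alpha>" "0 \<le> \<beta>" "0 \<le> \<gamma>" "y = sgn (\<alpha> *\<^sub>R a + \<beta> *\<^sub>R b + \<gamma> *\<^sub>R c)"
    by (auto simp: spherical_triangle_def convex_hull_3)
  define k where "k = inverse (norm (\<alpha> *\<^sub>R a + \<beta> *\<^sub>R b + \<gamma> *\<^sub>R c))"
  have "y = (k * \<alpha>) *\<^sub>R a + (k * \<beta>) *\<^sub>R b + (k * \<gamma>) *\<^sub>R c"
    using *(4) by (simp add: sgn_div_norm k_def scaleR_add_right)
  moreover have "k \<ge> 0" by (simp add: k_def)
  ultimately show "\<exists>\<alpha> \<beta> \<gamma>. 0 \<le> \<alpha> \<and> 0 \<le> \<beta> \<and> 0 \<le> \<gamma> \<and> y = \<alpha> *\<^sub>R a + \<beta> *\<^sub>R b + \<gamma> *\<^sub>R c"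
    using * by (metis mult_nonneg_nonneg)
next
  assume "\<exists>\<alpha> \<beta> \<gamma>. 0 \<le> \<alpha> \<and> 0 \<le> \<beta> \<and> 0 \<le> \<gamma> \<and> y = \<alpha> *\<^sub>R a + \<beta> *\<^sub>R b + \<gamma> *\<^sub>R c"
  then obtain \<alpha> \<beta> \<gamma> where *: "0 \<le> \<alpha>" "0 \<le> \<beta>" "0 \<le> \<gamma>" "y = \<alpha> *\<^sub>R a + \<beta> *\<^sub>R b + \<gamma> *\<^sub>R c" by blast
  define s where "s = \<alpha> + \<beta> + \<gamma>"
  have "s \<noteq> 0"
    using * assms by (auto simp: s_def add_nonneg_eq_0_iff)
  then have s: "s > 0" using * by (simp add: s_def)
  have "(\<alpha> / s) + (\<beta> / s) + (\<gamma> / s) = 1"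
    using s by (simp add: s_def flip: add_divide_distrib)
  then have "(\<alpha> / s) *\<^sub>R a + (\<beta> / s) *\<^sub>R b + (\<gamma> / s) *\<^sub>R c \<in> convex hull {a, b, c}"
    using * s unfolding convex_hull_3 by (intro CollectI exI conjI) auto
  moreover have "(\<alpha> / s) *\<^sub>R a + (\<beta> / s) *\<^sub>R b + (\<gamma> / s) *\<^sub>R c = (1 / s) *\<^sub>R y"
    using *(4) by (simp add: scaleR_add_right)
  moreover have "sgn ((1 / s) *\<^sub>R y) = y"
    using s assms by (simp add: sgn_div_norm)
  ultimately show "y \<in> spherical_triangle a b c"
    unfolding spherical_triangle_def by (metis imageI)
qed

lemma compact_spherical_triangle:
  assumes "0 \<notin> convex hull {a, b, c}"
  shows "compact (spherical_triangle a b c)"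
  unfolding spherical_triangle_def sgn_div_norm
proof (rule compact_continuous_image)
  show "continuous_on (convex hull {a, b, c}) (\<lambda>x. x /\<^sub>R norm x)"
    using assms by (intro continuous_intros) auto
  show "compact (convex hull {a, b, c})"
    by (rule finite_imp_compact_convex_hull) simp
qed

text \<open>A great circle missing the pole has the polar equation cot \<theta> = a cos \<phi> + b
  sin \<phi>. The coefficients here make it pass through the two other vertices: the right side is
  cot \<open>\<rho>\<^sub>0\<close> at azimuth 0 and cot \<open>\<rho>\<^sub>1\<close> at azimuth C.
  The triangle lies on the polar side of it.\<close>

lemma sp3_mem_polar_triangle_iff:
  assumes \<rho>: "0 < \<rho>\<^sub>0" "\<rho>\<^sub>0 < pi" "0 < \<rho>\<^sub>1" "\<rho>\<^sub>1 < pi" and C: "0 < C" "C < pi"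
    and \<theta>: "0 < \<theta>" "\<theta> < pi" and \<phi>: "0 \<le> \<phi>" "\<phi> < 2 * pi"
  shows "sp3 \<theta> \<phi> \<in> spherical_triangle (axis 3 1) (sp3 \<rho>\<^sub>0 0) (sp3 \<rho>\<^sub>1 C) \<longleftrightarrow>
     \<phi> \<le> C \<and> sin \<theta> * (cot \<rho>\<^sub>0 * cos \<phi> + (cot \<rho>\<^sub>1 - cot \<rho>\<^sub>0 * cos C) / sin C * sin \<phi>) \<le> cos \<theta>"
    (is "?L \<longleftrightarrow> _ \<and> sin \<theta> * ?q \<le> _")
proof -
  have s: "sin \<rho>\<^sub>0 > 0" "sin \<rho>\<^sub>1 > 0" "sin C > 0" "sin \<theta> > 0"
    using assms by (auto intro: sin_gt_zero)
  have "sp3 \<theta> \<phi> = \<alpha> *\<^sub>R axis 3 1 + \<beta> *\<^sub>R sp3 \<rho>\<^sub>0 0 + \<gamma> *\<^sub>R sp3 \<rho>\<^sub>1 C \<longleftrightarrow>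
      \<beta> * sin \<rho>\<^sub>0 + \<gamma> * sin \<rho>\<^sub>1 * cos C = sin \<theta> * cos \<phi> \<and> \<gamma> * sin \<rho>\<^sub>1 * sin C = sin \<theta> * sin \<phi> \<and>
      \<alpha> + \<beta> * cos \<rho>\<^sub>0 + \<gamma> * cos \<rho>\<^sub>1 = cos \<theta>" for \<alpha> \<beta> \<gamma>
    by (simp add: vec_eq_iff forall_3 axis_component mult.assoc) (metis (no_types))
  then have "?L \<longleftrightarrow> (\<exists>\<alpha> \<beta> \<gamma>. 0 \<le> \<alpha> \<and> 0 \<le> \<beta> \<and> 0 \<le> \<gamma> \<and>
      \<beta> * sin \<rho>\<^sub>0 + \<gamma> * sin \<rho>\<^sub>1 * cos C = sin \<theta> * cos \<phi> \<and> \<gamma> * sin \<rho>\<^sub>1 * sin C = sin \<theta> * sin \<phi> \<and>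
      \<alpha> + \<beta> * cos \<rho>\<^sub>0 + \<gamma> * cos \<rho>\<^sub>1 = cos \<theta>)"
    by (simp only: mem_spherical_triangle_iff[OF norm_sp3])
  also have "\<dots> \<longleftrightarrow> 0 \<le> sin \<phi> \<and> 0 \<le> sin (C - \<phi>) \<and> sin \<theta> * ?q \<le> cos \<theta>"
  proof -
    \<comment> \<open>Cramer's rule for the first two coordinates. The third coordinate then fixes
      \<alpha>, and 0 \<le> \<alpha> is the inequality with cos \<theta>.\<close>
    define \<gamma>' where "\<gamma>' = sin \<theta> * sin \<phi> / (sin \<rho>\<^sub>1 * sin C)"
    define \<beta>' where "\<beta>' = sin \<theta> * sin (C - \<phi>) / (sin \<rho>\<^sub>0 * sin C)"
    have q: "sin \<theta> * ?q = \<beta>' * cos \<rho>\<^sub>0 + \<gamma>' * cos \<rho>\<^sub>1"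
      using s by (simp add: \<beta>'_def \<gamma>'_def cot_def sin_diff field_simps)
    have "\<gamma> * sin \<rho>\<^sub>1 * sin C = sin \<theta> * sin \<phi> \<longleftrightarrow> \<gamma> = \<gamma>'" for \<gamma>
      using s by (auto simp: \<gamma>'_def field_simps)
    moreover have "\<beta> * sin \<rho>\<^sub>0 + \<gamma>' * sin \<rho>\<^sub>1 * cos C = sin \<theta> * cos \<phi> \<longleftrightarrow> \<beta> = \<beta>'" for \<beta>
      using s by (auto simp: \<beta>'_def \<gamma>'_def sin_diff field_simps)
    ultimately have "(\<exists>\<alpha> \<beta> \<gamma>. 0 \<le> \<alpha> \<and> 0 \<le> \<beta> \<and> 0 \<le> \<gamma> \<and>
      \<beta> * sin \<rho>\<^sub>0 + \<gamma> * sin \<rho>\<^sub>1 * cos C = sin \<theta> * cos \<phi> \<and> \<gamma> * sin \<rho>\<^sub>1 * sin C = sin \<theta> * sin \<phi> \<and>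
      \<alpha> + \<beta> * cos \<rho>\<^sub>0 + \<gamma> * cos \<rho>\<^sub>1 = cos \<theta>) \<longleftrightarrow>
      (\<exists>\<alpha>. 0 \<le> \<alpha> \<and> 0 \<le> \<beta>' \<and> 0 \<le> \<gamma>' \<and> \<alpha> + \<beta>' * cos \<rho>\<^sub>0 + \<gamma>' * cos \<rho>\<^sub>1 = cos \<theta>)"
      by metis
    also have "\<dots> \<longleftrightarrow> 0 \<le> \<beta>' \<and> 0 \<le> \<gamma>' \<and> sin \<theta> * ?q \<le> cos \<theta>"
      unfolding q by (auto intro: exI[of _ "cos \<theta> - (\<beta>' * cos \<rho>\<^sub>0 + \<gamma>' * cos \<rho>\<^sub>1)"])
    also have "0 \<le> \<gamma>' \<longleftrightarrow> 0 \<le> sin \<phi>"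
      unfolding \<gamma>'_def using s mult_pos_pos[OF s(2,3)]
      by (auto simp: zero_le_divide_iff zero_le_mult_iff mult_le_0_iff)
    also have "0 \<le> \<beta>' \<longleftrightarrow> 0 \<le> sin (C - \<phi>)"
      unfolding \<beta>'_def using s mult_pos_pos[OF s(1,3)]
      by (auto simp: zero_le_divide_iff zero_le_mult_iff mult_le_0_iff)
    finally show ?thesis by blast
  qed
  also have "\<dots> \<longleftrightarrow> \<phi> \<le> C \<and> sin \<theta> * ?q \<le> cos \<theta>"
  proof -
    have "\<phi> \<le> C" if "0 \<le> sin \<phi>" "0 \<le> sin (C - \<phi>)"
    proof (rule ccontr)
      assume "\<not> \<phi> \<le> C"
      have "\<phi> \<le> pi"
        using that(1) sin_lt_zero[of \<phi>] \<phi> by force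
      then have "sin (\<phi> - C) > 0"
        using \<open>\<not> \<phi> \<le> C\<close> C by (intro sin_gt_zero) auto
      with that(2) show False using sin_minus[of "\<phi> - C"] by simp
    qed
    moreover have "0 \<le> sin \<phi> \<and> 0 \<le> sin (C - \<phi>)" if "\<phi> \<le> C"
      using that \<phi> C by (auto intro: sin_ge_zero)
    ultimately show ?thesis by blast
  qed
  finally show ?thesis .
qed

lemma polar_triangle_zero_notin:
  assumes "0 < \<rho>\<^sub>0" "\<rho>\<^sub>0 < pi" "0 < \<rho>\<^sub>1" "\<rho>\<^sub>1 < pi" "0 < C" "C < pi"
  shows "0 \<notin> convex hull {axis 3 1, sp3 \<rho>\<^sub>0 0, sp3 \<rho>\<^sub>1 C}"
proof
  have s: "sin \<rho>\<^sub>0 > 0" "sin \<rho>\<^sub>1 > 0" "sin C > 0"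
    using assms by (auto intro: sin_gt_zero)
  assume "0 \<in> convex hull {axis 3 1, sp3 \<rho>\<^sub>0 0, sp3 \<rho>\<^sub>1 C}"
  then obtain \<alpha> \<beta> \<gamma> where *: "\<alpha> + \<beta> + \<gamma> = 1" "0 = \<alpha> *\<^sub>R axis 3 1 + \<beta> *\<^sub>R sp3 \<rho>\<^sub>0 0 + \<gamma> *\<^sub>R sp3 \<rho>\<^sub>1 C"
    unfolding convex_hull_3 by auto
  have "\<gamma> = 0"
    using arg_cong[OF *(2), of "\<lambda>v. v $ 2"] s by (auto simp: axis_component)
  moreover from this have "\<beta> = 0"
    using arg_cong[OF *(2), of "\<lambda>v. v $ 1"] s by (auto simp: axis_component)
  ultimately show False
    using arg_cong[OF *(2), of "\<lambda>v. v $ 3"] *(1) by (auto simp: axis_component)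
qed

section \<open>Integration over polar angle and azimuth\<close>

lemma tan_half_diff:
  fixes x y :: real
  assumes "- (pi / 2) < x" "x < pi / 2" "- (pi / 2) < y" "y < pi / 2"
  shows "tan ((x - y) / 2) = (sin x - sin y) / (cos x + cos y)"
proof -
  have "cos ((x + y) / 2) > 0" "cos ((x - y) / 2) > 0"
    using assms by (auto intro!: cos_gt_zero_pi)
  then show ?thesis
    unfolding sin_diff_sin cos_plus_cos by (simp add: tan_def)
qed

text \<open>
  For suitable \<open>a\<close>, \<open>b\<close> the integrand is the cosine of the polar angle at which the meridian of
  azimuth \<open>\<phi>\<close> meets the side opposite to the pole.
\<close>

lemma arcsin_antiderivative:
  fixes a b \<phi> :: real
  defines "q \<equiv> \<lambda>x. a * cos x + b * sin x" and "q' \<equiv> \<lambda>x. b * cos x - a * sin x"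
    and "L \<equiv> sqrt (1 + a\<^sup>2 + b\<^sup>2)"
  shows "((\<lambda>x. arcsin (- q' x / L)) has_real_derivative q \<phi> / sqrt (1 + (q \<phi>)\<^sup>2)) (at \<phi>)"
    and "cos (arcsin (- q' \<phi> / L)) = sqrt (1 + (q \<phi>)\<^sup>2) / L"
    and "- 1 < - q' \<phi> / L" and "- q' \<phi> / L < 1"
proof -
  \<comment> \<open>\<open>q'\<close> is the derivative of \<open>q\<close>, and q^2 + q'^2 is the
    constant a^2 + b^2.\<close>
  have Lsq: "L\<^sup>2 = 1 + (q \<phi>)\<^sup>2 + (q' \<phi>)\<^sup>2"
  proof -
    have "L\<^sup>2 = 1 + a\<^sup>2 + b\<^sup>2" by (simp add: L_def)
    then show ?thesis using sin_cos_squared_add[of \<phi>] unfolding q_def q'_def by algebra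
  qed
  have L: "L > 0" unfolding L_def by (simp add: add_pos_nonneg)
  have q1: "1 + (q \<phi>)\<^sup>2 > 0" by (simp add: add_pos_nonneg)
  have "(q' \<phi>)\<^sup>2 < L\<^sup>2"
    using Lsq q1 by simp
  then have "(q' \<phi> / L)\<^sup>2 < 1"
    using L by (simp add: power_divide)
  then have "\<bar>q' \<phi> / L\<bar> < 1"
    by (simp add: abs_square_less_1)
  then show lt: "- 1 < - q' \<phi> / L" "- q' \<phi> / L < 1"
    unfolding abs_less_iff by simp_all
  have cs: "sqrt (1 - (- q' \<phi> / L)\<^sup>2) = sqrt (1 + (q \<phi>)\<^sup>2) / L"
  proof -
    have "1 - (- q' \<phi> / L)\<^sup>2 = (L\<^sup>2 - (q' \<phi>)\<^sup>2) / L\<^sup>2"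
      using L by (simp add: power_divide diff_divide_distrib)
    also have "L\<^sup>2 - (q' \<phi>)\<^sup>2 = 1 + (q \<phi>)\<^sup>2" using Lsq by simp
    finally have "1 - (- q' \<phi> / L)\<^sup>2 = (1 + (q \<phi>)\<^sup>2) / L\<^sup>2" .
    then show ?thesis using L by (simp add: real_sqrt_divide)
  qed
  then show "cos (arcsin (- q' \<phi> / L)) = sqrt (1 + (q \<phi>)\<^sup>2) / L"
    using lt by (subst cos_arcsin) simp_all
  have "((\<lambda>x. - q' x / L) has_real_derivative q \<phi> / L) (at \<phi>)"
    unfolding q_def q'_def using L by (auto intro!: derivative_eq_intros)
  moreover have "DERIV arcsin (- q' \<phi> / L) :> inverse (sqrt (1 - (- q' \<phi> / L)\<^sup>2))"
    using lt by (rule DERIV_arcsin)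
  ultimately have "((\<lambda>x. arcsin (- q' x / L)) has_real_derivative inverse (sqrt (1 - (- q' \<phi> / L)\<^sup>2)) * (q \<phi> / L)) (at \<phi>)"
    by (rule DERIV_chain2[rotated])
  then show "((\<lambda>x. arcsin (- q' x / L)) has_real_derivative q \<phi> / sqrt (1 + (q \<phi>)\<^sup>2)) (at \<phi>)"
    unfolding cs using L by (simp add: field_simps)
qed

text \<open>The condition means \<theta> \<le> \<rho> for the angle \<rho> with cot \<rho> = q, and
  sin integrates to 1 - cos \<rho>.\<close>

lemma nn_integral_polar_slice:
  fixes q :: real
  shows "(\<integral>\<^sup>+ \<theta>. ennreal (indicator {\<theta>. 0 < \<theta> \<and> \<theta> < pi \<and> sin \<theta> * q \<le> cos \<theta>} \<theta> * sin \<theta>) \<partial>lborel)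
     = ennreal (1 - q / sqrt (1 + q\<^sup>2))"
proof -
  define Q where "Q = q / sqrt (1 + q\<^sup>2)"
  have q1: "1 + q\<^sup>2 > 0" by (simp add: add_pos_nonneg)
  have "Q\<^sup>2 = q\<^sup>2 / (1 + q\<^sup>2)" using q1 by (simp add: Q_def power_divide)
  then have Qsq: "1 - Q\<^sup>2 = 1 / (1 + q\<^sup>2)" using q1 by (simp add: field_simps)
  then have "Q\<^sup>2 < 1" using q1 by (smt (verit) zero_less_divide_1_iff)
  then have Q: "\<bar>Q\<bar> < 1" by (simp add: abs_square_less_1)
  define \<rho> where "\<rho> = arccos Q"
  have \<rho>: "0 < \<rho>" "\<rho> < pi" using Q arccos_lt_bounded[of Q] by (auto simp: \<rho>_def)
  have c: "cos \<rho> = Q" using Q by (simp add: \<rho>_def)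
  have s: "sin \<rho> = 1 / sqrt (1 + q\<^sup>2)" using Q Qsq by (simp add: \<rho>_def sin_arccos_abs real_sqrt_divide)
  have iff: "sin \<theta> * q \<le> cos \<theta> \<longleftrightarrow> \<theta> \<le> \<rho>" if "0 < \<theta>" "\<theta> < pi" for \<theta>
  proof -
    \<comment> \<open>After this division the coefficients are cos \<rho> and sin \<rho>, so the
      difference of the sides is sin (\<rho> - \<theta>).\<close>
    have "sin \<theta> * q \<le> cos \<theta> \<longleftrightarrow> sin \<theta> * q / sqrt (1 + q\<^sup>2) \<le> cos \<theta> / sqrt (1 + q\<^sup>2)"
      using q1 by (simp add: divide_le_cancel)
    also have "\<dots> \<longleftrightarrow> 0 \<le> sin (\<rho> - \<theta>)"
      using c s by (simp add: sin_diff Q_def mult.commute)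
    also have "\<dots> \<longleftrightarrow> \<theta> \<le> \<rho>"
      using that \<rho> sin_gt_zero[of "\<theta> - \<rho>"] sin_minus[of "\<theta> - \<rho>"] sin_ge_zero[of "\<rho> - \<theta>"] by (cases "\<theta> \<le> \<rho>") auto
    finally show ?thesis .
  qed
  have "(\<integral>\<^sup>+ \<theta>. ennreal (indicator {\<theta>. 0 < \<theta> \<and> \<theta> < pi \<and> sin \<theta> * q \<le> cos \<theta>} \<theta> * sin \<theta>) \<partial>lborel)
     = (\<integral>\<^sup>+ \<theta>. ennreal (sin \<theta>) * indicator {0..\<rho>} \<theta> \<partial>lborel)"
  proof (rule nn_integral_cong)
    fix \<theta> :: real
    show "ennreal (indicator {\<theta>. 0 < \<theta> \<and> \<theta> < pi \<and> sin \<theta> * q \<le> cos \<theta>} \<theta> * sin \<theta>) = ennreal (sin \<theta>) * indicator {0..\<rho>} \<theta>"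
      using iff[of \<theta>] \<rho> by (cases "\<theta> = 0") (auto simp: indicator_def)
  qed
  also have "\<dots> = ennreal (- cos \<rho> - - cos 0)"
    using \<rho> by (intro nn_integral_FTC_Icc) (auto intro!: derivative_eq_intros sin_ge_zero)
  finally show ?thesis by (simp add: c Q_def)
qed

text \<open>Integrating the slices over the azimuth gives C minus the increment of an arcsine, and
  \<delta> is half that increment. The tangent of half a difference is then expressed by sines and
  cosines at the two ends, which yields Napier's analogy without ever introducing the base
  angles.\<close>

lemma sphere_area_polar_triangle:
  assumes \<rho>: "0 < \<rho>\<^sub>0" "\<rho>\<^sub>0 < pi" "0 < \<rho>\<^sub>1" "\<rho>\<^sub>1 < pi" and C: "0 < C" "C < pi"
  obtains \<delta> where "- (pi / 2) < \<delta>" "\<delta> < pi / 2"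
    and "sphere_area (spherical_triangle (axis 3 1) (sp3 \<rho>\<^sub>0 0) (sp3 \<rho>\<^sub>1 C)) = C - 2 * \<delta>"
    and "tan \<delta> = tan (C / 2) * ((cos \<rho>\<^sub>0 * sin \<rho>\<^sub>1 + cos \<rho>\<^sub>1 * sin \<rho>\<^sub>0) / (sin \<rho>\<^sub>0 + sin \<rho>\<^sub>1))"
proof -
  have s: "sin \<rho>\<^sub>0 > 0" "sin \<rho>\<^sub>1 > 0" "sin C > 0" "cos (C / 2) > 0" "sin (C / 2) > 0"
    using assms by (auto intro: sin_gt_zero cos_gt_zero_pi)
  define T where "T = spherical_triangle (axis 3 1) (sp3 \<rho>\<^sub>0 0) (sp3 \<rho>\<^sub>1 C)"
  define a where "a = cot \<rho>\<^sub>0"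
  define b where "b = (cot \<rho>\<^sub>1 - cot \<rho>\<^sub>0 * cos C) / sin C"
  define q where "q = (\<lambda>x. a * cos x + b * sin x)"
  define q' where "q' = (\<lambda>x. b * cos x - a * sin x)"
  define L where "L = sqrt (1 + a\<^sup>2 + b\<^sup>2)"
  define \<beta> where "\<beta> = (\<lambda>x. arcsin (- q' x / L))"
  have L: "L > 0" unfolding L_def by (simp add: add_pos_nonneg)
  have anti: "(\<beta> has_real_derivative q x / sqrt (1 + (q x)\<^sup>2)) (at x)"
    "cos (\<beta> x) = sqrt (1 + (q x)\<^sup>2) / L" "- 1 < - q' x / L" "- q' x / L < 1" for x
    using arcsin_antiderivative[where a = a and b = b and \<phi> = x] by (simp_all only: \<beta>_def q_def q'_def L_def)
  have "compact T"
    unfolding T_def by (intro compact_spherical_triangle polar_triangle_zero_notin assms)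
  then have [measurable]: "T \<in> sets borel" by (rule borel_compact)
  \<comment> \<open>At \<theta> = 0 and \<theta> = pi both sides vanish, so the membership criterion
    is needed only strictly between the poles.\<close>
  have slice_eq: "ennreal (area_integrand T (\<theta>, \<phi>)) = ennreal (indicator {\<theta>. 0 < \<theta> \<and> \<theta> < pi \<and> sin \<theta> * q \<phi> \<le> cos \<theta>} \<theta> * sin \<theta>) * indicator {0..C} \<phi>" for \<theta> \<phi>
  proof (cases "0 < \<theta> \<and> \<theta> < pi \<and> 0 \<le> \<phi> \<and> \<phi> < 2 * pi")
    case True
    then show ?thesis
      using sp3_mem_polar_triangle_iff[OF assms, of \<theta> \<phi>]
      by (auto simp: area_integrand_def T_def q_def a_def b_def indicator_def)
  next
    case False
    then have "\<theta> = 0 \<or> \<theta> = pi \<or> (\<theta>, \<phi>) \<notin> {0..pi} \<times> {0..<2 * pi}"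
      by auto
    then show ?thesis
      using False C by (auto simp: area_integrand_def indicator_def)
  qed
  have derF: "((\<lambda>x. x - \<beta> x) has_real_derivative 1 - q x / sqrt (1 + (q x)\<^sup>2)) (at x)" for x
    by (intro DERIV_diff anti(1) DERIV_ident)
  have nonneg: "0 \<le> 1 - q x / sqrt (1 + (q x)\<^sup>2)" for x
  proof -
    have "q x \<le> sqrt (1 + (q x)\<^sup>2)" by (rule real_le_rsqrt) simp
    then show ?thesis by (simp add: divide_le_eq add_pos_nonneg)
  qed
  have "sphere_area T = enn2real (\<integral>\<^sup>+ w. ennreal (area_integrand T w) \<partial>lborel)"
    by (rule sphere_area_eq_nn_integral) simp
  also have "(\<integral>\<^sup>+ w. ennreal (area_integrand T w) \<partial>lborel) = (\<integral>\<^sup>+ w. ennreal (area_integrand T w) \<partial>(lborel \<Otimes>\<^sub>M lborel))"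
    by (simp only: lborel_prod)
  also have "\<dots> = (\<integral>\<^sup>+ \<phi>. \<integral>\<^sup>+ \<theta>. ennreal (area_integrand T (\<theta>, \<phi>)) \<partial>lborel \<partial>lborel)"
    by (subst lborel_pair.nn_integral_snd) (auto simp: lborel_prod)
  also have "\<dots> = (\<integral>\<^sup>+ \<phi>. ennreal (1 - q \<phi> / sqrt (1 + (q \<phi>)\<^sup>2)) * indicator {0..C} \<phi> \<partial>lborel)"
    unfolding slice_eq by (subst nn_integral_multc) (auto simp: nn_integral_polar_slice)
  also have "\<dots> = ennreal ((C - \<beta> C) - (0 - \<beta> 0))"
  proof (rule nn_integral_FTC_Icc)
    show "(\<lambda>\<phi>. 1 - q \<phi> / sqrt (1 + (q \<phi>)\<^sup>2)) \<in> borel_measurable borel"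
      unfolding q_def by measurable
  qed (use C derF nonneg in \<open>auto intro: has_field_derivative_at_within\<close>)
  finally have area: "sphere_area T = enn2real (ennreal (C - \<beta> C + \<beta> 0))" by simp
  show thesis
  proof (rule that[of "(\<beta> C - \<beta> 0) / 2"])
    have \<beta>: "- (pi / 2) < \<beta> x" "\<beta> x < pi / 2" for x
      using arcsin_lt_bounded[OF anti(3,4)[of x]] by (simp_all add: \<beta>_def)
    show "- (pi / 2) < (\<beta> C - \<beta> 0) / 2" "(\<beta> C - \<beta> 0) / 2 < pi / 2"
      using \<beta>[of C] \<beta>[of 0] by auto
    have sinb: "sin (\<beta> x) = - q' x / L" for x
      unfolding \<beta>_def using anti(3,4)[of x] by (intro sin_arcsin) simp_all
    \<comment> \<open>Since \<open>q\<close> equals the cotangent of a leg at each end, this turns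
      both values of cos \<beta> into cosecants divided by \<open>L\<close>.\<close>
    have csc: "sqrt (1 + (cot x)\<^sup>2) = 1 / sin x" if "sin x > 0" for x :: real
      using that by (simp add: one_plus_cot_squared real_sqrt_inverse inverse_eq_divide[symmetric])
    have q0: "q 0 = cot \<rho>\<^sub>0" by (simp add: q_def a_def)
    have qC: "q C = cot \<rho>\<^sub>1" using s by (simp add: q_def a_def b_def)
    have t: "tan (C / 2) = (1 - cos C) / sin C"
      using s cos_double_sin[of "C / 2"] sin_double[of "C / 2"] by (simp add: tan_def power2_eq_square)
    have "q' 0 - q' C = b * (1 - cos C) + a * sin C"
      by (simp add: q'_def algebra_simps)
    also have "\<dots> = (cot \<rho>\<^sub>0 + cot \<rho>\<^sub>1) * tan (C / 2)"
    proof -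
      have "sin C * sin C = (1 - cos C) * (1 + cos C)"
        using sin_cos_squared_add[of C] by algebra
      then have sC: "sin C = (1 - cos C) * (1 + cos C) / sin C"
        using s by (simp add: nonzero_eq_divide_eq)
      have "b * (1 - cos C) + a * sin C = b * (1 - cos C) + a * ((1 - cos C) * (1 + cos C) / sin C)"
        using sC by simp
      also have "\<dots> = (b * sin C + a * (1 + cos C)) * ((1 - cos C) / sin C)"
        using s by (simp add: field_simps)
      also have "b * sin C = cot \<rho>\<^sub>1 - a * cos C"
        using s by (simp add: b_def a_def)
      finally show ?thesis
        unfolding t a_def by (simp add: algebra_simps)
    qed
    finally have diff: "q' 0 - q' C = (cot \<rho>\<^sub>0 + cot \<rho>\<^sub>1) * tan (C / 2)" .
    have "tan ((\<beta> C - \<beta> 0) / 2) = (sin (\<beta> C) - sin (\<beta> 0)) / (cos (\<beta> C) + cos (\<beta> 0))"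
      using \<beta> by (intro tan_half_diff) auto
    also have "cos (\<beta> C) + cos (\<beta> 0) = (1 / sin \<rho>\<^sub>1 + 1 / sin \<rho>\<^sub>0) / L"
      using anti(2)[of 0] anti(2)[of C] s by (simp add: q0 qC csc add_divide_distrib)
    also have "sin (\<beta> C) - sin (\<beta> 0) = (cot \<rho>\<^sub>0 + cot \<rho>\<^sub>1) * tan (C / 2) / L"
      unfolding sinb diff[symmetric] by (simp add: diff_divide_distrib)
    also have "(cot \<rho>\<^sub>0 + cot \<rho>\<^sub>1) * tan (C / 2) / L / ((1 / sin \<rho>\<^sub>1 + 1 / sin \<rho>\<^sub>0) / L)
        = tan (C / 2) * ((cos \<rho>\<^sub>0 * sin \<rho>\<^sub>1 + cos \<rho>\<^sub>1 * sin \<rho>\<^sub>0) / (sin \<rho>\<^sub>0 + sin \<rho>\<^sub>1))"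
    proof -
      have "cot \<rho>\<^sub>0 + cot \<rho>\<^sub>1 = (cos \<rho>\<^sub>0 * sin \<rho>\<^sub>1 + cos \<rho>\<^sub>1 * sin \<rho>\<^sub>0) / (sin \<rho>\<^sub>0 * sin \<rho>\<^sub>1)"
        using s by (simp add: cot_def field_simps)
      moreover have "1 / sin \<rho>\<^sub>1 + 1 / sin \<rho>\<^sub>0 = (sin \<rho>\<^sub>0 + sin \<rho>\<^sub>1) / (sin \<rho>\<^sub>0 * sin \<rho>\<^sub>1)"
        using s by (simp add: field_simps)
      ultimately show ?thesis using s L by simp
    qed
    finally show "tan ((\<beta> C - \<beta> 0) / 2) = tan (C / 2) * ((cos \<rho>\<^sub>0 * sin \<rho>\<^sub>1 + cos \<rho>\<^sub>1 * sin \<rho>\<^sub>0) / (sin \<rho>\<^sub>0 + sin \<rho>\<^sub>1))" .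
    \<comment> \<open>Needed to undo \<open>ennreal\<close>, which truncates negative reals to
      0.\<close>
    have "0 - \<beta> 0 \<le> C - \<beta> C"
    proof (rule DERIV_nonneg_imp_nondecreasing[of 0 C "\<lambda>x. x - \<beta> x"])
      show "\<exists>y. ((\<lambda>x. x - \<beta> x) has_real_derivative y) (at x) \<and> 0 \<le> y" for x
        using derF[of x] nonneg[of x] by blast
    qed (use C in simp)
    then show "sphere_area (spherical_triangle (axis 3 1) (sp3 \<rho>\<^sub>0 0) (sp3 \<rho>\<^sub>1 C)) = C - 2 * ((\<beta> C - \<beta> 0) / 2)"
      using area by (simp add: T_def field_simps)
  qed
qed

section \<open>Wedges around a vertex\<close>

text \<open>No handedness is imposed: a star traversed in the other sense is treated in the frame
  with \<open>w\<close> negated.\<close>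

locale orthonormal_frame =
  fixes v u w :: "real^3"
  assumes norms: "norm v = 1" "norm u = 1" "norm w = 1"
    and orth: "u \<bullet> w = 0" "v \<bullet> u = 0" "v \<bullet> w = 0"
begin

lemma inner_frame [simp]:
  "v \<bullet> v = 1" "u \<bullet> u = 1" "w \<bullet> w = 1" "u \<bullet> w = 0" "w \<bullet> u = 0" "v \<bullet> u = 0" "u \<bullet> v = 0" "v \<bullet> w = 0" "w \<bullet> v = 0"
  using norms orth by (simp_all add: dot_square_norm inner_commute)

definition frame_map :: "real^3 \<Rightarrow> real^3" where
  "frame_map x = x $ 1 *\<^sub>R u + x $ 2 *\<^sub>R w + x $ 3 *\<^sub>R v"

lemma orthogonal_frame_map: "orthogonal_transformation frame_map"
  unfolding orthogonal_transformation_def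
proof (intro conjI allI)
  show "linear frame_map"
    by (rule linearI) (simp_all add: frame_map_def algebra_simps)
  have "frame_map x \<bullet> frame_map y = x $ 1 * y $ 1 + x $ 2 * y $ 2 + x $ 3 * y $ 3" for x y
    by (simp add: frame_map_def inner_add_left inner_add_right)
  then show "frame_map x \<bullet> frame_map y = x \<bullet> y" for x y
    by (simp add: inner_vec_def sum_3)
qed

lemma frame_map_axis3: "frame_map (axis 3 1) = v"
  by (simp add: frame_map_def axis_component)

lemma frame_map_sp3: "frame_map (sp3 \<theta> \<phi>) = spherical_point v u w \<theta> \<phi>"
  by (simp add: frame_map_def) (simp add: spherical_point_def)

text \<open>Turning the frame by \<phi> shifts azimuths, so that any wedge can be made to start at
  azimuth 0.\<close>

lemma rotated_frame: "orthonormal_frame v (cos \<phi> *\<^sub>R u + sin \<phi> *\<^sub>R w) (cos \<phi> *\<^sub>R w - sin \<phi> *\<^sub>R u)"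
  by unfold_locales
    (simp_all add: norm_eq_1 inner_simps algebra_simps flip: power2_eq_square)

lemma spherical_point_rotated_frame:
  "spherical_point v (cos \<phi> *\<^sub>R u + sin \<phi> *\<^sub>R w) (cos \<phi> *\<^sub>R w - sin \<phi> *\<^sub>R u) \<theta> \<psi> = spherical_point v u w \<theta> (\<phi> + \<psi>)"
  by (simp add: spherical_point_def sin_add cos_add algebra_simps)

end

text \<open>The tetrahedron is a linear image of the standard simplex, of volume 1/3!, under a map
  whose determinant is the product of the three sines.\<close>

lemma measure_polar_tetrahedron:
  assumes \<rho>: "0 < \<rho>\<^sub>0" "\<rho>\<^sub>0 < pi" "0 < \<rho>\<^sub>1" "\<rho>\<^sub>1 < pi" and C: "0 < C" "C < pi"
  shows "measure lebesgue (convex hull {0, axis 3 1, sp3 \<rho>\<^sub>0 0, sp3 \<rho>\<^sub>1 C}) = sin \<rho>\<^sub>0 * sin \<rho>\<^sub>1 * sin C / 6"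
proof -
  have s: "sin \<rho>\<^sub>0 > 0" "sin \<rho>\<^sub>1 > 0" "sin C > 0"
    using assms by (auto intro: sin_gt_zero)
  define f :: "real^3 \<Rightarrow> real^3" where "f = (\<lambda>x. x $ 1 *\<^sub>R sp3 \<rho>\<^sub>0 0 + x $ 2 *\<^sub>R sp3 \<rho>\<^sub>1 C + x $ 3 *\<^sub>R axis 3 1)"
  have lin: "linear f"
    by (rule linearI) (simp_all add: f_def algebra_simps)
  have Basis3: "Basis = {axis 1 1, axis 2 1, axis 3 1 :: real^3}"
    unfolding Basis_vec_def by (auto simp: UNIV_3)
  have "f ` insert 0 Basis = {0, sp3 \<rho>\<^sub>0 0, sp3 \<rho>\<^sub>1 C, axis 3 1}"
    unfolding Basis3 by (simp add: f_def axis_component)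
  also have "\<dots> = {0, axis 3 1, sp3 \<rho>\<^sub>0 0, sp3 \<rho>\<^sub>1 C}" by blast
  finally have hull: "convex hull {0, axis 3 1, sp3 \<rho>\<^sub>0 0, sp3 \<rho>\<^sub>1 C} = f ` (convex hull (insert 0 Basis))"
    by (simp only: convex_hull_linear_image[OF lin])
  have "measure lebesgue (f ` (convex hull (insert 0 Basis))) = \<bar>det (matrix f)\<bar> * measure lebesgue (convex hull (insert 0 (Basis :: (real^3) set)))"
    by (intro measure_linear_image lin lmeasurable_compact finite_imp_compact_convex_hull) simp
  also have "det (matrix f) = sin \<rho>\<^sub>0 * sin \<rho>\<^sub>1 * sin C"
    unfolding det_3 by (simp add: matrix_def f_def axis_component)
  also have "measure lebesgue (convex hull (insert 0 (Basis :: (real^3) set))) = 1 / 6"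
    using content_std_simplex[where 'a = "real^3"]
    by (simp add: finite_imp_compact_convex_hull borel_compact fact_numeral)
  finally show ?thesis using s by (simp add: hull)
qed

text \<open>The orthogonal map of the frame turned by \<phi> carries the polar triangle and
  tetrahedron to this wedge.\<close>

lemma (in orthonormal_frame) spherical_wedge:
  fixes \<rho>\<^sub>0 \<rho>\<^sub>1 C \<phi> :: real
  assumes \<rho>: "0 < \<rho>\<^sub>0" "\<rho>\<^sub>0 < pi" "0 < \<rho>\<^sub>1" "\<rho>\<^sub>1 < pi" and C: "0 < C" "C < pi"
  defines "p \<equiv> spherical_point v u w \<rho>\<^sub>0 \<phi>" and "q \<equiv> spherical_point v u w \<rho>\<^sub>1 (\<phi> + C)"
  obtains \<delta> where "- (pi / 2) < \<delta>" "\<delta> < pi / 2"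
    and "sphere_area (spherical_triangle v p q) = C - 2 * \<delta>"
    and "tan \<delta> = tan (C / 2) * ((cos \<rho>\<^sub>0 * sin \<rho>\<^sub>1 + cos \<rho>\<^sub>1 * sin \<rho>\<^sub>0) / (sin \<rho>\<^sub>0 + sin \<rho>\<^sub>1))"
    and "measure lebesgue (convex hull {0, v, p, q}) = sin \<rho>\<^sub>0 * sin \<rho>\<^sub>1 * sin C / 6"
proof -
  interpret R: orthonormal_frame v "cos \<phi> *\<^sub>R u + sin \<phi> *\<^sub>R w" "cos \<phi> *\<^sub>R w - sin \<phi> *\<^sub>R u"
    by (rule rotated_frame)
  note orth = R.orthogonal_frame_map
  have im: "R.frame_map (axis 3 1) = v" "R.frame_map (sp3 \<rho>\<^sub>0 0) = p" "R.frame_map (sp3 \<rho>\<^sub>1 C) = q"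
    by (simp_all only: R.frame_map_axis3 R.frame_map_sp3 spherical_point_rotated_frame p_def q_def add_0_right)
  have "spherical_triangle v p q = R.frame_map ` spherical_triangle (axis 3 1) (sp3 \<rho>\<^sub>0 0) (sp3 \<rho>\<^sub>1 C)"
    using spherical_triangle_orthogonal_image[OF orth, of "axis 3 1" "sp3 \<rho>\<^sub>0 0" "sp3 \<rho>\<^sub>1 C"] by (simp only: im)
  then have area: "sphere_area (spherical_triangle v p q) = sphere_area (spherical_triangle (axis 3 1) (sp3 \<rho>\<^sub>0 0) (sp3 \<rho>\<^sub>1 C))"
    using sphere_area_orthogonal_image[OF orth compact_spherical_triangle[OF polar_triangle_zero_notin[OF assms(1-6)]]] by simp
  have "convex hull {0, v, p, q} = R.frame_map ` (convex hull {0, axis 3 1, sp3 \<rho>\<^sub>0 0, sp3 \<rho>\<^sub>1 C})"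
    using orthogonal_transformation_linear[OF orth]
    by (simp add: convex_hull_linear_image linear_0 im)
  then have vol: "measure lebesgue (convex hull {0, v, p, q}) = sin \<rho>\<^sub>0 * sin \<rho>\<^sub>1 * sin C / 6"
    using measure_orthogonal_image[OF orth, of "convex hull {0, axis 3 1, sp3 \<rho>\<^sub>0 0, sp3 \<rho>\<^sub>1 C}"] measure_polar_tetrahedron[OF assms(1-6)]
    by (simp add: lmeasurable_compact finite_imp_compact_convex_hull)
  from sphere_area_polar_triangle[OF assms(1-6)] obtain \<delta> where "- (pi / 2) < \<delta>" "\<delta> < pi / 2"
    and "sphere_area (spherical_triangle (axis 3 1) (sp3 \<rho>\<^sub>0 0) (sp3 \<rho>\<^sub>1 C)) = C - 2 * \<delta>"
    and "tan \<delta> = tan (C / 2) * ((cos \<rho>\<^sub>0 * sin \<rho>\<^sub>1 + cos \<rho>\<^sub>1 * sin \<rho>\<^sub>0) / (sin \<rho>\<^sub>0 + sin \<rho>\<^sub>1))" .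
  then show thesis using that area vol by simp
qed

text \<open>In half sum and half difference the left side is M - P and the squared ratio is P / M.
  The right side is therefore (M - P) / M with 0 < M \<le> 1, and M = 1 when x = y.\<close>

lemma sin_mult_le:
  fixes x y :: real
  assumes "sin x > 0" "sin y > 0"
  shows "sin x * sin y \<le> 1 - ((cos x * sin y + cos y * sin x) / (sin x + sin y))\<^sup>2"
proof -
  define P where "P = (cos ((x + y) / 2))\<^sup>2"
  define M where "M = (cos ((x - y) / 2))\<^sup>2"
  have half: "cos z = 2 * (cos (z / 2))\<^sup>2 - 1" for z :: real
    by (metis cos_double_cos field_sum_of_halves mult_2)
  have half_sin: "sin z = 2 * sin (z / 2) * cos (z / 2)" for z :: real
    by (metis sin_double field_sum_of_halves mult_2)
  have xy: "sin x * sin y = M - P"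
    using half[of "x - y"] half[of "x + y"] cos_diff[of x y] cos_add[of x y]
    by (simp add: P_def M_def)
  have sxy: "sin x + sin y > 0" using assms by simp
  have "sin x + sin y = 2 * sin ((x + y) / 2) * cos ((x - y) / 2)"
    by (rule sin_plus_sin)
  moreover have "cos x * sin y + cos y * sin x = 2 * sin ((x + y) / 2) * cos ((x + y) / 2)"
    using sin_add[of x y] half_sin[of "x + y"] by (simp add: algebra_simps)
  ultimately have r: "((cos x * sin y + cos y * sin x) / (sin x + sin y))\<^sup>2 = P / M"
    using sxy by (auto simp: P_def M_def power_divide)
  have M: "0 < M" "M \<le> 1"
    using sxy \<open>sin x + sin y = _\<close> by (auto simp: M_def power_le_one_iff abs_square_le_1)
  have "M - P > 0" using xy assms by (metis mult_pos_pos)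
  have "M * (M - P) \<le> 1 * (M - P)"
    using M \<open>M - P > 0\<close> by (intro mult_right_mono) auto
  then have "M - P \<le> 1 - P / M"
    using M by (simp add: field_simps)
  then show ?thesis
    by (simp only: xy r)
qed

text \<open>By the hypothesis on tan \<delta>, cot (C / 2) * tan \<delta> is exactly the ratio r, so
  \<open>wedge_bound (C / 2) \<delta>\<close> is sin C * (1 - r^2).\<close>

lemma wedge_volume_le_wedge_bound:
  assumes "0 < \<rho>\<^sub>0" "\<rho>\<^sub>0 < pi" "0 < \<rho>\<^sub>1" "\<rho>\<^sub>1 < pi" "0 < C" "C < pi"
    and t: "tan \<delta> = tan (C / 2) * ((cos \<rho>\<^sub>0 * sin \<rho>\<^sub>1 + cos \<rho>\<^sub>1 * sin \<rho>\<^sub>0) / (sin \<rho>\<^sub>0 + sin \<rho>\<^sub>1))"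
  shows "sin \<rho>\<^sub>0 * sin \<rho>\<^sub>1 * sin C / 6 \<le> wedge_bound (C / 2) \<delta> / 6"
proof -
  have s: "sin \<rho>\<^sub>0 > 0" "sin \<rho>\<^sub>1 > 0" "sin C > 0" "cos (C / 2) > 0" "sin (C / 2) > 0"
    using assms by (auto intro: sin_gt_zero cos_gt_zero_pi)
  then have "cot (C / 2) * tan (C / 2) = 1"
    by (simp add: cot_def tan_def)
  then have "cot (C / 2) * tan \<delta> = (cos \<rho>\<^sub>0 * sin \<rho>\<^sub>1 + cos \<rho>\<^sub>1 * sin \<rho>\<^sub>0) / (sin \<rho>\<^sub>0 + sin \<rho>\<^sub>1)"
    unfolding t by (metis mult.assoc mult_1)
  then show ?thesis
    using mult_right_mono[OF sin_mult_le[of \<rho>\<^sub>0 \<rho>\<^sub>1], of "sin C"] s by (simp add: wedge_bound_def mult.commute)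
qed

section \<open>Three wedges filling one full turn\<close>

context orthonormal_frame
begin

text \<open>Azimuths are lifted to the real line, with entry 4 standing for the return to the first
  point, so the gaps add up to 2 pi rather than to a multiple of it. Gaps below pi keep the half
  gaps inside the domain of concavity.\<close>

definition cyclic_azimuths :: "(nat \<Rightarrow> real^3) \<Rightarrow> (nat \<Rightarrow> real) \<Rightarrow> (nat \<Rightarrow> real) \<Rightarrow> bool" where
  "cyclic_azimuths p \<rho> \<psi> \<longleftrightarrow>
     (\<forall>i\<in>{1..4}. 0 < \<rho> i \<and> \<rho> i < pi \<and> p i = spherical_point v u w (\<rho> i) (\<psi> i)) \<and>
     (\<forall>i\<in>{1..3}. \<psi> i < \<psi> (i + 1) \<and> \<psi> (i + 1) < \<psi> i + pi) \<and> \<psi> 4 = \<psi> 1 + 2 * pi"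

text \<open>One \<delta> is chosen for each wedge; the gaps telescope to 2 pi in the total
  area.\<close>

lemma cyclic_azimuths_wedges:
  assumes "cyclic_azimuths p \<rho> \<psi>"
  defines "C \<equiv> \<lambda>i. \<psi> (i + 1) - \<psi> i"
  obtains \<delta> where "\<forall>i\<in>{1..3}. - (pi / 2) < \<delta> i \<and> \<delta> i < pi / 2"
    and "\<forall>i\<in>{1..3}. tan (\<delta> i) = tan (C i / 2) *
       ((cos (\<rho> i) * sin (\<rho> (i + 1)) + cos (\<rho> (i + 1)) * sin (\<rho> i)) / (sin (\<rho> i) + sin (\<rho> (i + 1))))"
    and "\<forall>i\<in>{1..3}. measure lebesgue (convex hull {0, v, p i, p (i + 1)}) = sin (\<rho> i) * sin (\<rho> (i + 1)) * sin (C i) / 6"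
    and "(\<Sum>i=1..3. sphere_area (spherical_triangle v (p i) (p (i + 1)))) = 2 * pi - 2 * (\<Sum>i=1..3. \<delta> i)"
proof -
  have "\<exists>d. - (pi / 2) < d \<and> d < pi / 2 \<and>
      sphere_area (spherical_triangle v (p i) (p (i + 1))) = C i - 2 * d \<and>
      tan d = tan (C i / 2) *
       ((cos (\<rho> i) * sin (\<rho> (i + 1)) + cos (\<rho> (i + 1)) * sin (\<rho> i)) / (sin (\<rho> i) + sin (\<rho> (i + 1)))) \<and>
      measure lebesgue (convex hull {0, v, p i, p (i + 1)}) = sin (\<rho> i) * sin (\<rho> (i + 1)) * sin (C i) / 6"
    if i: "i \<in> {1..3}" for i
  proof -
    have i': "i \<in> {1..4}" "i + 1 \<in> {1..4}" using i by auto
    have \<rho>: "0 < \<rho> i" "\<rho> i < pi" "0 < \<rho> (i + 1)" "\<rho> (i + 1) < pi" "0 < C i" "C i < pi"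
      and p: "p i = spherical_point v u w (\<rho> i) (\<psi> i)" "p (i + 1) = spherical_point v u w (\<rho> (i + 1)) (\<psi> i + C i)"
      using assms(1) i i' unfolding cyclic_azimuths_def C_def by (simp_all add: algebra_simps)
    show ?thesis
      unfolding p by (rule spherical_wedge[OF \<rho>, of "\<psi> i"]) blast
  qed
  then obtain \<delta> where \<delta>: "\<forall>i\<in>{1..3}. - (pi / 2) < \<delta> i \<and> \<delta> i < pi / 2 \<and>
      sphere_area (spherical_triangle v (p i) (p (i + 1))) = C i - 2 * \<delta> i \<and>
      tan (\<delta> i) = tan (C i / 2) *
       ((cos (\<rho> i) * sin (\<rho> (i + 1)) + cos (\<rho> (i + 1)) * sin (\<rho> i)) / (sin (\<rho> i) + sin (\<rho> (i + 1)))) \<and>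
      measure lebesgue (convex hull {0, v, p i, p (i + 1)}) = sin (\<rho> i) * sin (\<rho> (i + 1)) * sin (C i) / 6"
    by (metis (no_types, lifting))
  have "(\<Sum>i=1..3. sphere_area (spherical_triangle v (p i) (p (i + 1)))) = (\<Sum>i=1..3. C i - 2 * \<delta> i)"
    using \<delta> by (intro sum.cong) auto
  also have "\<dots> = (\<Sum>i=1..3. C i) - 2 * (\<Sum>i=1..3. \<delta> i)"
    by (simp add: sum_subtractf sum_distrib_left)
  also have "(\<Sum>i=1..3. C i) = 2 * pi"
    using assms(1) by (simp add: C_def cyclic_azimuths_def eval_nat_numeral)
  finally show thesis
    using that[of \<delta>] \<delta> by blast
qed

lemma cyclic_azimuths_volume_le:
  assumes cyc: "cyclic_azimuths p \<rho> \<psi>"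
    and \<alpha>: "\<alpha> = (\<Sum>i=1..3. sphere_area (spherical_triangle v (p i) (p (i + 1))))"
  shows "(\<Sum>i=1..3. measure lebesgue (convex hull {0, v, p i, p (i + 1)}))
              \<le> sqrt 3 / 4 * (1 - 1 / 3 * (tan ((2 * pi - \<alpha>) / 6))\<^sup>2)"
proof -
  let ?C = "\<lambda>i. \<psi> (i + 1) - \<psi> i"
  obtain \<delta> where
    \<delta>: "\<forall>i\<in>{1..3}. - (pi / 2) < \<delta> i \<and> \<delta> i < pi / 2"
    "\<forall>i\<in>{1..3}. tan (\<delta> i) = tan (?C i / 2) *
       ((cos (\<rho> i) * sin (\<rho> (i + 1)) + cos (\<rho> (i + 1)) * sin (\<rho> i)) / (sin (\<rho> i) + sin (\<rho> (i + 1))))"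
    and vol: "\<forall>i\<in>{1..3}. measure lebesgue (convex hull {0, v, p i, p (i + 1)}) = sin (\<rho> i) * sin (\<rho> (i + 1)) * sin (?C i) / 6"
    and area: "(\<Sum>i=1..3. sphere_area (spherical_triangle v (p i) (p (i + 1)))) = 2 * pi - 2 * (\<Sum>i=1..3. \<delta> i)"
    by (rule cyclic_azimuths_wedges[OF cyc]) (rule that)
  have C: "0 < ?C i \<and> ?C i < pi" if "i \<in> {1..3}" for i
    using cyc that by (auto simp: cyclic_azimuths_def algebra_simps)
  have C2: "0 < ?C i / 2 \<and> ?C i / 2 < pi / 2" if "i \<in> {1..3}" for i
    using C[OF that] by simp
  have \<rho>: "0 < \<rho> i" "\<rho> i < pi" "0 < \<rho> (i + 1)" "\<rho> (i + 1) < pi" if "i \<in> {1..3}" for i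
    using cyc that by (auto simp: cyclic_azimuths_def)
  have sumC: "(\<Sum>i=1..3. ?C i / 2) = pi"
    using cyc by (simp add: cyclic_azimuths_def eval_nat_numeral flip: sum_divide_distrib)
  have "(\<Sum>i=1..3. measure lebesgue (convex hull {0, v, p i, p (i + 1)})) \<le> (\<Sum>i=1..3. wedge_bound (?C i / 2) (\<delta> i) / 6)"
  proof (rule sum_mono)
    fix i :: nat assume i: "i \<in> {1..3}"
    show "measure lebesgue (convex hull {0, v, p i, p (i + 1)}) \<le> wedge_bound (?C i / 2) (\<delta> i) / 6"
      unfolding vol[rule_format, OF i]
      using wedge_volume_le_wedge_bound[OF \<rho>[OF i] _ _ \<delta>(2)[rule_format, OF i]] C[OF i] by blast
  qed
  also have "\<dots> = (\<Sum>i=1..3. wedge_bound (?C i / 2) (\<delta> i)) / 6"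
    by (simp only: sum_divide_distrib)
  also have "\<dots> \<le> 3 * sqrt 3 / 2 * (1 - 1 / 3 * (tan ((\<Sum>i=1..3. \<delta> i) / 3))\<^sup>2) / 6"
    by (intro divide_right_mono wedge_bound_sum_le C2 \<delta>(1)[rule_format] sumC) auto
  \<comment> \<open>The area is 2 pi minus twice the sum of the \<delta>, so this is the mean of the
    \<delta>.\<close>
  also have "(\<Sum>i=1..3. \<delta> i) / 3 = (2 * pi - \<alpha>) / 6"
    unfolding \<alpha> area by simp
  finally show ?thesis by simp
qed

text \<open>Both sides are evaluated directly. Every \<delta> is arctan (sqrt 3 * cos \<theta>),
  with sqrt 3 = tan (pi / 3), so the subtracted term is cos^2 \<theta> and both sides equal sqrt 3 /
  4 * sin^2 \<theta>.\<close>

lemma cyclic_azimuths_volume_eq: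
  assumes cyc: "cyclic_azimuths p (\<lambda>_. \<theta>) (\<lambda>i. real i * (2 * pi / 3))"
    and \<alpha>: "\<alpha> = (\<Sum>i=1..3. sphere_area (spherical_triangle v (p i) (p (i + 1))))"
  shows "(\<Sum>i=1..3. measure lebesgue (convex hull {0, v, p i, p (i + 1)}))
              = sqrt 3 / 4 * (1 - 1 / 3 * (tan ((2 * pi - \<alpha>) / 6))\<^sup>2)"
proof -
  have C: "real (i + 1) * (2 * pi / 3) - real i * (2 * pi / 3) = 2 * pi / 3" for i
    by (simp add: field_simps)
  have "0 < \<theta> \<and> \<theta> < pi"
    using cyc unfolding cyclic_azimuths_def by (metis atLeastAtMost_iff one_le_numeral order_refl)
  then have "0 < \<theta>" "\<theta> < pi" by simp_all
  then have s: "sin \<theta> > 0" by (rule sin_gt_zero)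
  obtain \<delta> where
    \<delta>: "\<forall>i\<in>{1..3}. - (pi / 2) < \<delta> i \<and> \<delta> i < pi / 2"
    "\<forall>i\<in>{1..3}. tan (\<delta> i) = tan ((real (i + 1) * (2 * pi / 3) - real i * (2 * pi / 3)) / 2) *
       ((cos \<theta> * sin \<theta> + cos \<theta> * sin \<theta>) / (sin \<theta> + sin \<theta>))"
    and vol: "\<forall>i\<in>{1..3}. measure lebesgue (convex hull {0, v, p i, p (i + 1)}) = sin \<theta> * sin \<theta> * sin (real (i + 1) * (2 * pi / 3) - real i * (2 * pi / 3)) / 6"
    and area: "(\<Sum>i=1..3. sphere_area (spherical_triangle v (p i) (p (i + 1)))) = 2 * pi - 2 * (\<Sum>i=1..3. \<delta> i)"
    by (rule cyclic_azimuths_wedges[OF cyc]) (rule that)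
  note \<delta> = \<delta>[unfolded C] and vol = vol[unfolded C]
  define d where "d = arctan (sqrt 3 * cos \<theta>)"
  have "\<delta> i = d" if i: "i \<in> {1..3}" for i
  proof -
    have "tan (\<delta> i) = sqrt 3 * cos \<theta>"
      using \<delta>(2)[rule_format, OF i] s tan_60 by (simp flip: distrib_left mult_2)
    then show ?thesis
      unfolding d_def using \<delta>(1)[rule_format, OF i] by (metis arctan_unique)
  qed
  then have "(\<Sum>i=1..3. \<delta> i) = 3 * d" by simp
  then have d: "(2 * pi - \<alpha>) / 6 = d" using \<alpha> area by simp
  have "(\<Sum>i=1..3. measure lebesgue (convex hull {0, v, p i, p (i + 1)})) = 3 * (sin \<theta> * sin \<theta> * sin (2 * pi / 3) / 6)"
    by (subst sum.cong[OF refl vol[rule_format]]) simp_all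
  also have "\<dots> = sqrt 3 / 4 * (1 - (cos \<theta>)\<^sup>2)"
    using sin_120 sin_squared_eq[of \<theta>] by (simp add: power2_eq_square)
  also have "(cos \<theta>)\<^sup>2 = 1 / 3 * (tan ((2 * pi - \<alpha>) / 6))\<^sup>2"
    unfolding d d_def by (simp add: tan_arctan power_mult_distrib)
  finally show ?thesis .
qed

end

section \<open>Azimuths of a degree-3 star\<close>

lemma exists_orthonormal_frame:
  assumes "norm v = 1"
  obtains u w where "orthonormal_frame v u w"
proof -
  have "norm (axis 3 (1::real) :: real^3) = norm v"
    using assms by (simp add: norm_axis_1)
  then obtain f where f: "orthogonal_transformation f" "f (axis 3 1 :: real^3) = v"
    by (rule orthogonal_transformation_exists)
  then have "f x \<bullet> f y = x \<bullet> y" for x y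
    by (simp add: orthogonal_transformation_def)
  from this[of "axis 3 1"] this[of "axis 1 1" "axis 1 1"] this[of "axis 2 1" "axis 2 1"] this[of "axis 1 1" "axis 2 1"]
  have "orthonormal_frame v (f (axis 1 1)) (f (axis 2 1))"
    using assms unfolding orthonormal_frame_def norm_eq_1 f(2)
    by (simp add: inner_axis_axis)
  then show thesis by (rule that)
qed

context orthonormal_frame
begin

lemma surj_frame_map: "\<exists>y. x = frame_map y"
  using orthogonal_transformation_surj[OF orthogonal_frame_map] by (metis surjD)

lemma inner_frame_map:
  "u \<bullet> frame_map y = y $ 1" "w \<bullet> frame_map y = y $ 2" "v \<bullet> frame_map y = y $ 3"
  by (simp_all add: frame_map_def inner_add_right)

lemma inner_spherical_point [simp]:
  "u \<bullet> spherical_point v u w \<theta> \<phi> = sin \<theta> * cos \<phi>" "w \<bullet> spherical_point v u w \<theta> \<phi> = sin \<theta> * sin \<phi>"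
  "v \<bullet> spherical_point v u w \<theta> \<phi> = cos \<theta>"
  by (simp_all add: spherical_point_def inner_add_right)

lemma polar_coordinates:
  assumes "norm p = 1" and "u \<bullet> p \<noteq> 0 \<or> w \<bullet> p \<noteq> 0"
  obtains \<rho> \<phi> where "0 < \<rho>" "\<rho> < pi" "0 \<le> \<phi>" "\<phi> < 2 * pi" "p = spherical_point v u w \<rho> \<phi>"
proof -
  obtain x where x: "p = frame_map x" using surj_frame_map by blast
  have "x $ 1 \<noteq> 0 \<or> x $ 2 \<noteq> 0"
    using assms(2) by (simp add: x inner_frame_map)
  from spherical_coordinates[OF this] obtain y where y: "x = spherical_map y" "0 < y $ 2" "y $ 2 < pi" "0 \<le> y $ 3" "y $ 3 < 2 * pi" "y $ 1 = norm x"
    by metis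
  have "norm x = 1"
    using assms(1) by (simp add: x orthogonal_transformation_norm[OF orthogonal_frame_map])
  then have "x = sp3 (y $ 2) (y $ 3)"
    using y(6) y(1) by (metis scaleR_one spherical_map_def)
  then show thesis
    using that[of "y $ 2" "y $ 3"] y(2-5) by (simp add: x frame_map_sp3)
qed

text \<open>The planar cross product of the projections along \<open>v\<close>. For points in polar
  coordinates it is the product of the sines of their polar angles and the sine of the azimuth
  difference, so its sign tells whether that difference is below pi modulo a full turn.\<close>

definition cross2 :: "real^3 \<Rightarrow> real^3 \<Rightarrow> real" where
  "cross2 x y = (u \<bullet> x) * (w \<bullet> y) - (w \<bullet> x) * (u \<bullet> y)"

text \<open>
  The projection of \<open>k\<close> to the plane of \<open>u\<close>, \<open>w\<close> is orthogonal to that of \<open>p\<close>, so \<open>k\<close> acts on both \<open>q\<close>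
  and \<open>r\<close> as the same multiple of \<open>cross2 p\<close>.
\<close>

lemma cross2_opposite:
  assumes "k \<bullet> v = 0" "k \<bullet> p = 0" "k \<bullet> q > 0" "k \<bullet> r < 0" and "u \<bullet> p \<noteq> 0 \<or> w \<bullet> p \<noteq> 0"
  shows "cross2 p q * cross2 p r < 0"
proof -
  obtain k' p' q' r' where eq: "k = frame_map k'" "p = frame_map p'" "q = frame_map q'" "r = frame_map r'"
    using surj_frame_map by meson
  have inner: "frame_map x \<bullet> frame_map y = x $ 1 * y $ 1 + x $ 2 * y $ 2 + x $ 3 * y $ 3" for x y
    by (simp add: frame_map_def inner_add_left inner_add_right)
  have k3: "k' $ 3 = 0"
    using assms(1) by (simp add: eq inner_commute[of _ v] inner_frame_map)
  define a b where "a = k' $ 1" and "b = k' $ 2"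
  have p: "a * p' $ 1 + b * p' $ 2 = 0" and q: "a * q' $ 1 + b * q' $ 2 > 0" and r: "a * r' $ 1 + b * r' $ 2 < 0"
    using assms(2-4) by (simp_all add: eq inner k3 a_def b_def)
  have c: "cross2 p q = p' $ 1 * q' $ 2 - p' $ 2 * q' $ 1" "cross2 p r = p' $ 1 * r' $ 2 - p' $ 2 * r' $ 1"
    by (simp_all add: cross2_def eq inner_frame_map)
  define s where "s = a * p' $ 2 - b * p' $ 1"
  have "a\<^sup>2 + b\<^sup>2 > 0" using q by (auto simp: sum_power2_gt_zero_iff)
  moreover have "(p' $ 1)\<^sup>2 + (p' $ 2)\<^sup>2 > 0"
    using assms(5) by (simp add: eq inner_frame_map sum_power2_gt_zero_iff)
  \<comment> \<open>Lagrange's identity, one of whose terms vanishes because the projections of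
    \<open>k\<close> and \<open>p\<close> are orthogonal.\<close>
  moreover have "s\<^sup>2 = (a\<^sup>2 + b\<^sup>2) * ((p' $ 1)\<^sup>2 + (p' $ 2)\<^sup>2)"
    using p unfolding s_def by algebra
  ultimately have s: "s\<^sup>2 > 0" by simp
  have "(a\<^sup>2 + b\<^sup>2) * cross2 p q = - s * (a * q' $ 1 + b * q' $ 2)"
       "(a\<^sup>2 + b\<^sup>2) * cross2 p r = - s * (a * r' $ 1 + b * r' $ 2)"
    using p unfolding c s_def by algebra+
  then have "(a\<^sup>2 + b\<^sup>2)\<^sup>2 * (cross2 p q * cross2 p r) = s\<^sup>2 * ((a * q' $ 1 + b * q' $ 2) * (a * r' $ 1 + b * r' $ 2))"
    by algebra
  also have "\<dots> < 0"
    using s q r by (intro mult_pos_neg)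
  finally show ?thesis
    by (simp add: mult_less_0_iff not_less)
qed

lemma off_axis:
  assumes "norm p = 1" "p \<noteq> v" "p \<noteq> - v"
  shows "u \<bullet> p \<noteq> 0 \<or> w \<bullet> p \<noteq> 0"
proof (rule ccontr)
  assume *: "\<not> ?thesis"
  obtain x where x: "p = frame_map x" using surj_frame_map by blast
  have "p = x $ 3 *\<^sub>R v"
    using * unfolding x inner_frame_map by (simp add: frame_map_def)
  then have "\<bar>x $ 3\<bar> = 1" "p = x $ 3 *\<^sub>R v" using assms(1) norms by auto
  then show False using assms(2,3) by (auto simp: abs_if split: if_splits)
qed

end

text \<open>The frame is turned until \<open>p\<close> has azimuth 0. The plane with normal
  \<open>k\<close> keeps \<open>q\<close> off the meridian plane of \<open>p\<close>, so negating
  \<open>w\<close> if necessary puts \<open>q\<close> on the positive side.\<close>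

lemma exists_frame_positive:
  assumes v: "norm v = 1" and p: "norm p = 1" "p \<noteq> v" "p \<noteq> - v"
    and k: "k \<bullet> v = 0" "k \<bullet> p = 0" "k \<bullet> q > 0" "k \<bullet> r < 0"
  obtains u w where "orthonormal_frame v u w" "u \<bullet> p > 0" "w \<bullet> p = 0" "w \<bullet> q > 0"
proof -
  obtain u0 w0 where "orthonormal_frame v u0 w0"
    using v by (rule exists_orthonormal_frame)
  then interpret F: orthonormal_frame v u0 w0 .
  obtain \<rho> \<phi> where \<rho>: "0 < \<rho>" "\<rho> < pi" and pp: "p = spherical_point v u0 w0 \<rho> \<phi>"
    using F.polar_coordinates[OF p(1) F.off_axis[OF p]] by metis
  define u w where "u = cos \<phi> *\<^sub>R u0 + sin \<phi> *\<^sub>R w0" and "w = cos \<phi> *\<^sub>R w0 - sin \<phi> *\<^sub>R u0"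
  interpret G: orthonormal_frame v u w
    unfolding u_def w_def by (rule F.rotated_frame)
  have "p = spherical_point v u w \<rho> 0"
    unfolding pp u_def w_def F.spherical_point_rotated_frame by simp
  then have up: "u \<bullet> p > 0" "w \<bullet> p = 0"
    using \<rho> by (simp_all add: sin_gt_zero)
  have "G.cross2 p q \<noteq> 0"
    using G.cross2_opposite[OF k] up by force
  then have "w \<bullet> q \<noteq> 0"
    using up by (simp add: G.cross2_def)
  then consider "w \<bullet> q > 0" | "(- w) \<bullet> q > 0" by fastforce
  then show thesis
  proof cases
    case 1
    then show ?thesis using that[of u w] up G.orthonormal_frame_axioms by blast
  next
    case 2
    have "orthonormal_frame v u (- w)"
      using G.orthonormal_frame_axioms by (simp add: orthonormal_frame_def)
    with 2 show ?thesis using that[of u "- w"] up by simp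
  qed
qed

text \<open>In a frame with the first azimuth 0 and the second in (0, pi), the plane of
  \<open>k\<close> through \<open>v\<close> and \<open>p 1\<close> forces the third azimuth beyond
  pi, which also bounds the last gap. The plane of \<open>l\<close> through \<open>v\<close> and
  \<open>p 2\<close> bounds the middle gap by pi.\<close>

lemma exists_cyclic_azimuths:
  fixes p :: "nat \<Rightarrow> real^3"
  assumes v: "norm v = 1" and p: "\<And>i. i \<in> {1..3} \<Longrightarrow> norm (p i) = 1 \<and> p i \<noteq> v \<and> p i \<noteq> - v" and p4: "p 4 = p 1"
    and k: "k \<bullet> v = 0" "k \<bullet> p 1 = 0" "k \<bullet> p 2 > 0" "k \<bullet> p 3 < 0"
    and l: "l \<bullet> v = 0" "l \<bullet> p 2 = 0" "l \<bullet> p 3 > 0" "l \<bullet> p 1 < 0"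
  obtains u w \<rho> \<psi> where "orthonormal_frame v u w" "orthonormal_frame.cyclic_azimuths v u w p \<rho> \<psi>"
proof -
  have p1: "norm (p 1) = 1" "p 1 \<noteq> v" "p 1 \<noteq> - v" and p2: "norm (p 2) = 1" "p 2 \<noteq> v" "p 2 \<noteq> - v"
    and p3: "norm (p 3) = 1" "p 3 \<noteq> v" "p 3 \<noteq> - v"
    using p[of 1] p[of 2] p[of 3] by auto
  obtain u w where F: "orthonormal_frame v u w" and uw: "u \<bullet> p 1 > 0" "w \<bullet> p 1 = 0" "w \<bullet> p 2 > 0"
    using exists_frame_positive[OF v p1 k] by metis
  interpret orthonormal_frame v u w by (rule F)
  obtain \<rho>\<^sub>1 \<phi>\<^sub>1 where 1: "0 < \<rho>\<^sub>1" "\<rho>\<^sub>1 < pi" "0 \<le> \<phi>\<^sub>1" "\<phi>\<^sub>1 < 2 * pi" "p 1 = spherical_point v u w \<rho>\<^sub>1 \<phi>\<^sub>1"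
    using p1(1) off_axis[OF p1] by (rule polar_coordinates)
  obtain \<rho>\<^sub>2 \<phi>\<^sub>2 where 2: "0 < \<rho>\<^sub>2" "\<rho>\<^sub>2 < pi" "0 \<le> \<phi>\<^sub>2" "\<phi>\<^sub>2 < 2 * pi" "p 2 = spherical_point v u w \<rho>\<^sub>2 \<phi>\<^sub>2"
    using p2(1) off_axis[OF p2] by (rule polar_coordinates)
  obtain \<rho>\<^sub>3 \<phi>\<^sub>3 where 3: "0 < \<rho>\<^sub>3" "\<rho>\<^sub>3 < pi" "0 \<le> \<phi>\<^sub>3" "\<phi>\<^sub>3 < 2 * pi" "p 3 = spherical_point v u w \<rho>\<^sub>3 \<phi>\<^sub>3"
    using p3(1) off_axis[OF p3] by (rule polar_coordinates)
  have s: "sin \<rho>\<^sub>1 > 0" "sin \<rho>\<^sub>2 > 0" "sin \<rho>\<^sub>3 > 0"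
    using 1 2 3 by (simp_all add: sin_gt_zero)
  have gt_pi: "pi < x" if "sin x < 0" "0 \<le> x" for x :: real
    using that sin_ge_zero[of x] by linarith
  have lt_pi: "x < pi" if "0 < sin x" "0 \<le> x" "x < 2 * pi" for x :: real
    using that sin_le_zero[of x] by linarith
  have "cross2 (p 1) (p 2) = (u \<bullet> p 1) * (w \<bullet> p 2)" "cross2 (p 1) (p 3) = (u \<bullet> p 1) * (w \<bullet> p 3)"
    "cross2 (p 2) (p 1) = - ((u \<bullet> p 1) * (w \<bullet> p 2))"
    using uw by (simp_all add: cross2_def)
  moreover have "(u \<bullet> p 1) * (w \<bullet> p 2) > 0" using uw by simp
  moreover have "cross2 (p 1) (p 2) * cross2 (p 1) (p 3) < 0" "cross2 (p 2) (p 3) * cross2 (p 2) (p 1) < 0"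
    using cross2_opposite[OF k off_axis[OF p1]] cross2_opposite[OF l off_axis[OF p2]] by blast+
  ultimately have "w \<bullet> p 3 < 0" and c23: "cross2 (p 2) (p 3) > 0"
    using uw by (auto simp: mult_less_0_iff zero_less_mult_iff)
  have "cos \<phi>\<^sub>1 > 0" "sin \<phi>\<^sub>1 = 0"
    using uw(1,2) s unfolding 1(5) by (simp_all add: zero_less_mult_iff)
  then have \<phi>\<^sub>1: "\<phi>\<^sub>1 = 0"
    using 1(3,4) sin_gt_zero[of \<phi>\<^sub>1] sin_lt_zero[of \<phi>\<^sub>1] by (cases "\<phi>\<^sub>1 = pi") force+
  have "sin \<phi>\<^sub>2 > 0"
    using uw(3) s by (simp add: 2(5) zero_less_mult_iff)
  then have \<phi>\<^sub>2: "0 < \<phi>\<^sub>2" "\<phi>\<^sub>2 < pi"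
    using 2(3,4) lt_pi[of \<phi>\<^sub>2] by (auto simp: less_le)
  have "sin \<phi>\<^sub>3 < 0"
    using \<open>w \<bullet> p 3 < 0\<close> s by (simp add: 3(5) mult_less_0_iff)
  then have \<phi>\<^sub>3: "pi < \<phi>\<^sub>3" using gt_pi 3 by blast
  have "cross2 (p 2) (p 3) = (sin \<rho>\<^sub>2 * sin \<rho>\<^sub>3) * sin (\<phi>\<^sub>3 - \<phi>\<^sub>2)"
    by (simp add: cross2_def 2(5) 3(5) sin_diff algebra_simps)
  then have "sin (\<phi>\<^sub>3 - \<phi>\<^sub>2) > 0"
    using c23 mult_pos_pos[OF s(2,3)] by (metis zero_less_mult_pos)
  then have \<phi>\<^sub>3\<^sub>2: "\<phi>\<^sub>3 - \<phi>\<^sub>2 < pi"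
    using \<phi>\<^sub>2 \<phi>\<^sub>3 3(4) by (intro lt_pi) auto
  \<comment> \<open>The default branches serve index 4: the same polar angle as index 1, and azimuth
    2 pi instead of 0.\<close>
  define \<rho> \<psi> where "\<rho> = (\<lambda>i::nat. if i = 2 then \<rho>\<^sub>2 else if i = 3 then \<rho>\<^sub>3 else \<rho>\<^sub>1)"
    and "\<psi> = (\<lambda>i::nat. if i = 1 then 0 else if i = 2 then \<phi>\<^sub>2 else if i = 3 then \<phi>\<^sub>3 else 2 * pi)"
  have "{1..3::nat} = {1, 2, 3}" "{1..4::nat} = {1, 2, 3, 4}" by auto
  moreover have "spherical_point v u w \<rho>\<^sub>1 (2 * pi) = spherical_point v u w \<rho>\<^sub>1 0"
    by (simp add: spherical_point_def)
  ultimately have "cyclic_azimuths p \<rho> \<psi>"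
    using 1 2 3 \<phi>\<^sub>1 \<phi>\<^sub>2 \<phi>\<^sub>3 \<phi>\<^sub>3\<^sub>2 p4
    unfolding cyclic_azimuths_def by (simp add: \<rho>_def \<psi>_def)
  with F show thesis by (rule that)
qed

section \<open>Supporting functionals of inscribed polytopes\<close>

lemma unit_vector_inner_less:
  fixes x y :: "'a::real_inner"
  assumes "norm x = 1" "norm y = 1" "x \<noteq> y"
  shows "x \<bullet> y < 1"
proof -
  have "(norm (x - y))\<^sup>2 = 2 - 2 * (x \<bullet> y)"
    using assms(1,2) unfolding norm_eq_1 by (simp add: power2_norm_eq_inner inner_diff inner_commute)
  moreover have "(norm (x - y))\<^sup>2 > 0" using assms(3) by simp
  ultimately show ?thesis by linarith
qed

text \<open>Strict convexity of the sphere: a unit vector outside \<open>S\<close> is cut off by the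
  half-space of points with inner product below 1 with it.\<close>

lemma unit_vector_in_convex_hull:
  fixes x :: "'a::real_inner"
  assumes "x \<in> convex hull S" "norm x = 1" "\<And>y. y \<in> S \<Longrightarrow> norm y = 1"
  shows "x \<in> S"
proof (rule ccontr)
  assume "x \<notin> S"
  then have "S \<subseteq> {y. x \<bullet> y < 1}"
    using unit_vector_inner_less[of x] assms by blast
  then have "convex hull S \<subseteq> {y. x \<bullet> y < 1}"
    by (rule hull_minimal) (rule convex_halfspace_lt)
  then have "x \<bullet> x < 1" using assms(1) by blast
  then show False using assms(2) by (simp add: norm_eq_1)
qed

text \<open>Faces of a polytope are exposed, and the interior origin makes the right-hand side of
  the supporting inequality positive, so it can be scaled to 1.\<close>

lemma proper_face_functional:
  fixes P :: "'a::euclidean_space set"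
  assumes "polytope P" "0 \<in> interior P" and F: "F face_of P" "F \<noteq> {}" "F \<noteq> P"
  obtains n where "\<forall>x\<in>P. n \<bullet> x \<le> 1" "F = P \<inter> {x. n \<bullet> x = 1}"
proof -
  have "F exposed_face_of P"
    using assms by (simp add: exposed_face_of_polyhedron polytope_imp_polyhedron)
  then obtain a b where ab: "a \<noteq> 0" "P \<subseteq> {x. a \<bullet> x \<le> b}" "F = P \<inter> {x. a \<bullet> x = b}"
    using F unfolding exposed_face_of by blast
  have "0 \<in> interior {x. a \<bullet> x \<le> b}"
    using assms(2) interior_mono[OF ab(2)] by blast
  then have b: "b > 0" using ab(1) by simp
  show thesis
  proof (rule that[of "a /\<^sub>R b"])
    show "F = P \<inter> {x. (a /\<^sub>R b) \<bullet> x = 1}"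
      unfolding ab(3) using b by (auto simp: field_simps)
    show "\<forall>x\<in>P. (a /\<^sub>R b) \<bullet> x \<le> 1"
      using ab(2) b by (auto simp: field_simps)
  qed
qed

text \<open>
  Scale the normals of the three facets at \<open>v\<close> to take the value 1 on their facets. The difference
  of two of them vanishes at \<open>v\<close> and at the common neighbour and separates the other two neighbours.
\<close>

lemma degree3_star_cyclic_azimuths:
  assumes star: "degree3_star v p" and v: "norm v = 1" and p: "norm (p 1) = 1" "norm (p 2) = 1" "norm (p 3) = 1" "p 4 = p 1"
  obtains u w \<rho> \<psi> where "orthonormal_frame v u w" "orthonormal_frame.cyclic_azimuths v u w p \<rho> \<psi>"
proof -
  obtain P where P: "simplicial_polytope3 P" "0 \<in> interior P"
    and facets: "{F. F facet_of P \<and> v \<in> F} =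
            {convex hull {v, p 1, p 2}, convex hull {v, p 2, p 3}, convex hull {v, p 3, p 1}}"
    using star unfolding degree3_star_def by blast
  have poly: "polytope P" "aff_dim P = 3" using P(1) by (simp_all add: simplicial_polytope3_def)
  have facet: "a \<noteq> v" "b \<noteq> v" "a \<noteq> b" "\<exists>n. n \<bullet> v = 1 \<and> n \<bullet> a = 1 \<and> n \<bullet> b = 1 \<and> (\<forall>x\<in>P. n \<bullet> x \<le> 1) \<and>
      (\<forall>x\<in>P. n \<bullet> x = 1 \<longrightarrow> norm x = 1 \<longrightarrow> x \<in> {v, a, b})" "a \<in> P" "b \<in> P"
    if F: "convex hull {v, a, b} facet_of P" and ab: "norm a = 1" "norm b = 1" for a b
  proof -
    have "aff_dim (convex hull {v, a, b}) = 2"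
      using F poly by (simp add: facet_of_def)
    \<comment> \<open>Dimension 2 forces the three generators to be distinct.\<close>
    then have "2 \<le> int (card {v, a, b}) - 1"
      using aff_dim_le_card[of "{v, a, b}"] by (simp add: aff_dim_convex_hull)
    then show "a \<noteq> v" "b \<noteq> v" "a \<noteq> b"
      by (auto simp: card_insert_if split: if_splits)
    have "convex hull {v, a, b} face_of P" "convex hull {v, a, b} \<noteq> {}" "convex hull {v, a, b} \<noteq> P"
      using F poly by (auto simp: facet_of_def)
    then obtain n where n: "\<forall>x\<in>P. n \<bullet> x \<le> 1" "convex hull {v, a, b} = P \<inter> {x. n \<bullet> x = 1}"
      by (rule proper_face_functional[OF poly(1) P(2)])
    have sub: "{v, a, b} \<subseteq> P \<inter> {x. n \<bullet> x = 1}"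
      unfolding n(2)[symmetric] by (rule hull_subset)
    then show "a \<in> P" "b \<in> P" by auto
    \<comment> \<open>The facet contains no other unit vector; this is what makes its normal
      strictly less than 1 at the third neighbour.\<close>
    have "x \<in> {v, a, b}" if "x \<in> P" "n \<bullet> x = 1" "norm x = 1" for x
    proof (rule unit_vector_in_convex_hull)
      show "x \<in> convex hull {v, a, b}" unfolding n(2) using that by simp
    qed (use ab v that in auto)
    then show "\<exists>n. n \<bullet> v = 1 \<and> n \<bullet> a = 1 \<and> n \<bullet> b = 1 \<and> (\<forall>x\<in>P. n \<bullet> x \<le> 1) \<and>
      (\<forall>x\<in>P. n \<bullet> x = 1 \<longrightarrow> norm x = 1 \<longrightarrow> x \<in> {v, a, b})"
      using sub n(1) by blast
  qed
  have F: "convex hull {v, p 1, p 2} facet_of P" "convex hull {v, p 2, p 3} facet_of P" "convex hull {v, p 3, p 1} facet_of P"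
  proof -
    have "convex hull {v, p 1, p 2} \<in> {F. F facet_of P \<and> v \<in> F}" "convex hull {v, p 2, p 3} \<in> {F. F facet_of P \<and> v \<in> F}"
      "convex hull {v, p 3, p 1} \<in> {F. F facet_of P \<and> v \<in> F}"
      unfolding facets by simp_all
    then show "convex hull {v, p 1, p 2} facet_of P" "convex hull {v, p 2, p 3} facet_of P" "convex hull {v, p 3, p 1} facet_of P"
      by simp_all
  qed
  note d = facet(1-3)[OF F(1) p(1,2)] facet(1-3)[OF F(2) p(2,3)] facet(1-3)[OF F(3) p(3,1)]
  note mem = facet(5,6)[OF F(1) p(1,2)] facet(5)[OF F(3) p(3,1)]
  obtain n1 where n1: "n1 \<bullet> v = 1" "n1 \<bullet> p 1 = 1" "n1 \<bullet> p 2 = 1" "\<forall>x\<in>P. n1 \<bullet> x \<le> 1"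
      "\<forall>x\<in>P. n1 \<bullet> x = 1 \<longrightarrow> norm x = 1 \<longrightarrow> x \<in> {v, p 1, p 2}"
    using facet(4)[OF F(1) p(1,2)] by (elim exE conjE) (rule that)
  obtain n2 where n2: "n2 \<bullet> v = 1" "n2 \<bullet> p 2 = 1" "n2 \<bullet> p 3 = 1" "\<forall>x\<in>P. n2 \<bullet> x \<le> 1"
      "\<forall>x\<in>P. n2 \<bullet> x = 1 \<longrightarrow> norm x = 1 \<longrightarrow> x \<in> {v, p 2, p 3}"
    using facet(4)[OF F(2) p(2,3)] by (elim exE conjE) (rule that)
  obtain n3 where n3: "n3 \<bullet> v = 1" "n3 \<bullet> p 3 = 1" "n3 \<bullet> p 1 = 1" "\<forall>x\<in>P. n3 \<bullet> x \<le> 1"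
      "\<forall>x\<in>P. n3 \<bullet> x = 1 \<longrightarrow> norm x = 1 \<longrightarrow> x \<in> {v, p 3, p 1}"
    using facet(4)[OF F(3) p(3,1)] by (elim exE conjE) (rule that)
  have less: "n1 \<bullet> p 3 < 1" "n2 \<bullet> p 1 < 1" "n3 \<bullet> p 2 < 1"
  proof -
    have "p 3 \<notin> {v, p 1, p 2}" "p 1 \<notin> {v, p 2, p 3}" "p 2 \<notin> {v, p 3, p 1}"
      using d by auto
    then have "n1 \<bullet> p 3 \<noteq> 1" "n2 \<bullet> p 1 \<noteq> 1" "n3 \<bullet> p 2 \<noteq> 1"
      using n1(5) n2(5) n3(5) mem p(1-3) by blast+
    then show "n1 \<bullet> p 3 < 1" "n2 \<bullet> p 1 < 1" "n3 \<bullet> p 2 < 1"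
      using n1(4) n2(4) n3(4) mem by (simp_all add: less_le)
  qed
  \<comment> \<open>A normal that is 1 at \<open>v\<close> is -1 at \<open>- v\<close>, but it is 1
    at the neighbours on its facet.\<close>
  have neg: "p 1 \<noteq> - v" "p 2 \<noteq> - v" "p 3 \<noteq> - v"
    using n1(1-3) n2(1,3) by auto
  show thesis
  proof (rule exists_cyclic_azimuths[OF v _ p(4), of "n1 - n3" "n2 - n1"])
    show "norm (p i) = 1 \<and> p i \<noteq> v \<and> p i \<noteq> - v" if "i \<in> {1..3}" for i
    proof -
      have "i = 1 \<or> i = 2 \<or> i = 3" using that by auto
      then show ?thesis using p neg d by blast
    qed
  qed (use n1 n2 n3 less that in \<open>simp_all add: inner_diff_left\<close>)
qed

section \<open>The symmetric bipyramid\<close>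

text \<open>Reduces the classification of faces to listing the subsets of \<open>S\<close> on which
  a functional bounded by 1 can take the value 1.\<close>

lemma proper_face_convex_hull_functional:
  fixes S :: "'a::euclidean_space set"
  assumes "finite S" "0 \<in> interior (convex hull S)" and F: "F face_of convex hull S" "F \<noteq> {}" "F \<noteq> convex hull S"
  obtains n where "\<forall>s\<in>S. n \<bullet> s \<le> 1" "F = convex hull {s \<in> S. n \<bullet> s = 1}" "F \<subseteq> {x. n \<bullet> x = 1}"
proof -
  have "polytope (convex hull S)" using assms(1) by (auto simp: polytope_def)
  then obtain n where n: "\<forall>x\<in>convex hull S. n \<bullet> x \<le> 1" "F = convex hull S \<inter> {x. n \<bullet> x = 1}"
    using assms(2) F by (rule proper_face_functional)
  obtain T where T: "T \<subseteq> S" "F = convex hull T"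
    using face_of_convex_hull_subset[OF finite_imp_compact[OF assms(1)] F(1)] by blast
  have "T \<subseteq> {s \<in> S. n \<bullet> s = 1}"
    using hull_subset[of T convex] T n(2) by blast
  then have "F \<subseteq> convex hull {s \<in> S. n \<bullet> s = 1}"
    unfolding T(2) by (rule hull_mono)
  moreover have "convex hull {s \<in> S. n \<bullet> s = 1} \<subseteq> F"
    unfolding n(2) by (intro hull_minimal convex_Int convex_convex_hull convex_hyperplane) (auto intro: hull_inc)
  ultimately show thesis
    using n by (intro that[of n]) (auto intro: hull_inc)
qed

lemma face_of_convex_hull_functional:
  fixes S :: "'a::euclidean_space set"
  assumes "finite S" "\<forall>s\<in>S. n \<bullet> s \<le> 1"
  shows "convex hull {s \<in> S. n \<bullet> s = 1} face_of convex hull S"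
proof -
  have "convex hull S \<subseteq> {x. n \<bullet> x \<le> 1}"
    using assms(2) by (intro hull_minimal convex_halfspace_le) auto
  then have face: "convex hull S \<inter> {x. n \<bullet> x = 1} face_of convex hull S"
    by (intro face_of_Int_supporting_hyperplane_le) auto
  obtain T where T: "T \<subseteq> S" "convex hull S \<inter> {x. n \<bullet> x = 1} = convex hull T"
    using face_of_convex_hull_subset[OF finite_imp_compact[OF assms(1)] face] by blast
  have "T \<subseteq> {s \<in> S. n \<bullet> s = 1}"
    using hull_subset[of T convex] T by blast
  then have "convex hull S \<inter> {x. n \<bullet> x = 1} \<subseteq> convex hull {s \<in> S. n \<bullet> s = 1}"
    unfolding T(2) by (rule hull_mono)
  moreover have "convex hull {s \<in> S. n \<bullet> s = 1} \<subseteq> convex hull S \<inter> {x. n \<bullet> x = 1}"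
    by (intro hull_minimal convex_Int convex_convex_hull convex_hyperplane) (auto intro: hull_inc)
  ultimately show ?thesis using face by simp
qed

text \<open>Each point is kept off the line through the other two by a hyperplane containing
  them.\<close>

lemma affine_independent_3I:
  fixes a b c :: "'a::euclidean_space"
  assumes "l \<bullet> b = x" "l \<bullet> c = x" "l \<bullet> a \<noteq> x"
    and "m \<bullet> a = y" "m \<bullet> c = y" "m \<bullet> b \<noteq> y"
    and "n \<bullet> a = z" "n \<bullet> b = z" "n \<bullet> c \<noteq> z"
  shows "\<not> affine_dependent {a, b, c}"
proof -
  have *: "s \<notin> affine hull ({a, b, c} - {s})" if "k \<bullet> s \<noteq> t" "\<forall>s'\<in>{a, b, c} - {s}. k \<bullet> s' = t" for s k t
  proof -
    have "affine hull ({a, b, c} - {s}) \<subseteq> {x. k \<bullet> x = t}"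
      by (rule hull_minimal) (use that(2) in \<open>auto simp: affine_hyperplane\<close>)
    then show ?thesis using that(1) by blast
  qed
  have "a \<notin> affine hull ({a, b, c} - {a})"
    using assms(1-3) by (intro *[of l a x]) auto
  moreover have "b \<notin> affine hull ({a, b, c} - {b})"
    using assms(4-6) by (intro *[of m b y]) auto
  moreover have "c \<notin> affine hull ({a, b, c} - {c})"
    using assms(7-9) by (intro *[of n c z]) auto
  ultimately show ?thesis unfolding affine_dependent_def by blast
qed

text \<open>If 0 were not interior, there would be a nonzero functional nonnegative on
  \<open>S\<close>: from a hyperplane containing \<open>S\<close> when the interior is empty, and
  otherwise from one separating 0 from the interior.\<close>

lemma zero_in_interiorI:
  fixes S :: "'a::euclidean_space set"
  assumes "convex S" and "\<And>a. (\<And>x. x \<in> S \<Longrightarrow> 0 \<le> a \<bullet> x) \<Longrightarrow> a = 0" and "0 \<in> S"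
  shows "0 \<in> interior S"
proof (rule ccontr)
  assume 0: "0 \<notin> interior S"
  show False
  proof (cases "interior S = {}")
    case True
    then obtain a b where ab: "a \<noteq> 0" "S \<subseteq> {x. a \<bullet> x = b}"
      using empty_interior_subset_hyperplane[OF assms(1)] by metis
    then have "b = 0" using assms(3) by auto
    then have "a = 0" using ab(2) by (intro assms(2)) auto
    then show False using ab(1) by simp
  next
    case False
    obtain a where a: "a \<noteq> 0" "\<forall>x\<in>interior S. 0 \<le> a \<bullet> x"
      using separating_hyperplane_set_0[OF convex_interior[OF assms(1)] 0] by auto
    have "closure (interior S) \<subseteq> {x. 0 \<le> a \<bullet> x}"
      using a(2) closed_halfspace_ge[of 0 a] by (intro closure_minimal) auto
    then have "S \<subseteq> {x. 0 \<le> a \<bullet> x}"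
      using convex_closure_interior[OF assms(1) False] closure_subset by blast
    then have "a = 0" by (intro assms(2)) auto
    then show False using a(1) by simp
  qed
qed

text \<open>\<open>s\<close> and \<open>c\<close> stand for the sine and cosine of the polar angle.
  The base directions are given by inner products alone, so cyclic relabelling yields another
  instance and one facet and one edge have to be examined. \<open>spanning\<close> says that
  \<open>v\<close>, \<open>e1\<close>, \<open>e2\<close> span the space.\<close>

locale bipyramid =
  fixes v e1 e2 e3 :: "real^3" and s c :: real
  assumes unit: "v \<bullet> v = 1" "e1 \<bullet> e1 = 1" "e2 \<bullet> e2 = 1" "e3 \<bullet> e3 = 1"
    and ve: "v \<bullet> e1 = 0" "v \<bullet> e2 = 0" "v \<bullet> e3 = 0"
    and ee: "e1 \<bullet> e2 = - (1 / 2)" "e2 \<bullet> e3 = - (1 / 2)" "e3 \<bullet> e1 = - (1 / 2)"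
    and sum0: "e1 + e2 + e3 = 0"
    and spanning: "\<And>a. a \<bullet> v = 0 \<Longrightarrow> a \<bullet> e1 = 0 \<Longrightarrow> a \<bullet> e2 = 0 \<Longrightarrow> a = 0"
    and s: "s > 0" and sc: "s\<^sup>2 + c\<^sup>2 = 1"
begin

definition "q1 = s *\<^sub>R e1 + c *\<^sub>R v"
definition "q2 = s *\<^sub>R e2 + c *\<^sub>R v"
definition "q3 = s *\<^sub>R e3 + c *\<^sub>R v"

text \<open>The antipode of \<open>v\<close> brings the origin into the interior even for c > 0,
  when the other four points lie in one open half-space.\<close>

definition "V = {v, - v, q1, q2, q3}"

lemma rotate: "bipyramid v e2 e3 e1 s c"
proof
  show "a = 0" if "a \<bullet> v = 0" "a \<bullet> e2 = 0" "a \<bullet> e3 = 0" for a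
  proof (rule spanning)
    have "a \<bullet> (e1 + e2 + e3) = 0" by (simp add: sum0)
    then show "a \<bullet> e1 = 0" using that by (simp add: inner_add_right)
  qed (use that in auto)
  show "e2 + e3 + e1 = 0" using sum0 by (simp add: algebra_simps)
qed (use unit ve ee s sc in auto)

lemma inner_frame_vectors [simp]:
  "v \<bullet> v = 1" "e1 \<bullet> e1 = 1" "e2 \<bullet> e2 = 1" "e3 \<bullet> e3 = 1"
  "v \<bullet> e1 = 0" "v \<bullet> e2 = 0" "v \<bullet> e3 = 0" "e1 \<bullet> v = 0" "e2 \<bullet> v = 0" "e3 \<bullet> v = 0"
  "e1 \<bullet> e2 = - (1 / 2)" "e2 \<bullet> e3 = - (1 / 2)" "e3 \<bullet> e1 = - (1 / 2)"
  "e2 \<bullet> e1 = - (1 / 2)" "e3 \<bullet> e2 = - (1 / 2)" "e1 \<bullet> e3 = - (1 / 2)"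
  using unit ve ee by (simp_all add: inner_commute)

lemma c_bounds: "- 1 < c" "c < 1"
proof -
  have "c\<^sup>2 < 1" using sc s by (smt (verit) zero_less_power)
  then have "\<bar>c\<bar> < 1" by (simp add: abs_square_less_1)
  then show "- 1 < c" "c < 1" by auto
qed

lemma v_inner_q [simp]: "v \<bullet> q1 = c" "v \<bullet> q2 = c" "v \<bullet> q3 = c"
  by (simp_all add: q1_def q2_def q3_def inner_add_right)

lemma e_inner_q [simp]:
  "e1 \<bullet> q1 = s" "e1 \<bullet> q2 = - s / 2" "e1 \<bullet> q3 = - s / 2"
  "e2 \<bullet> q1 = - s / 2" "e2 \<bullet> q2 = s" "e2 \<bullet> q3 = - s / 2"
  "e3 \<bullet> q1 = - s / 2" "e3 \<bullet> q2 = - s / 2" "e3 \<bullet> q3 = s"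
  by (simp_all add: q1_def q2_def q3_def inner_add_right)

lemma sum_q: "q1 + q2 + q3 = (3 * c) *\<^sub>R v"
proof -
  have "q1 + q2 + q3 = s *\<^sub>R (e1 + e2 + e3) + (c + c + c) *\<^sub>R v"
    unfolding q1_def q2_def q3_def by (simp only: scaleR_add_left scaleR_add_right ac_simps)
  then show ?thesis by (simp add: sum0)
qed

lemma norm_V: "x \<in> V \<Longrightarrow> norm x = 1"
proof -
  have "s * s + c * c = 1" using sc by (simp add: power2_eq_square)
  then have "q1 \<bullet> q1 = 1" "q2 \<bullet> q2 = 1" "q3 \<bullet> q3 = 1"
    by (simp_all add: q1_def q2_def q3_def inner_add_left inner_add_right)
  then show "x \<in> V \<Longrightarrow> norm x = 1"
    unfolding V_def norm_eq_1 by auto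
qed

lemma distinct_V: "q1 \<noteq> v" "q2 \<noteq> v" "q3 \<noteq> v" "q1 \<noteq> - v" "q2 \<noteq> - v" "q3 \<noteq> - v" "q1 \<noteq> q2" "q2 \<noteq> q3" "q3 \<noteq> q1" "v \<noteq> - v"
proof -
  show "q1 \<noteq> v" "q2 \<noteq> v" "q3 \<noteq> v" "q1 \<noteq> - v" "q2 \<noteq> - v" "q3 \<noteq> - v"
    using c_bounds v_inner_q by (metis inner_minus_right inner_frame_vectors(1) less_irrefl)+
  show "q1 \<noteq> q2" "q2 \<noteq> q3" "q3 \<noteq> q1"
    using s e_inner_q by (smt (verit) field_sum_of_halves)+
  show "v \<noteq> - v"
    using inner_frame_vectors(1) by (metis inner_minus_right one_neq_neg_one)
qed

lemma finite_V: "finite V"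
  by (simp add: V_def)

text \<open>A functional nonnegative on \<open>v\<close> and \<open>- v\<close> vanishes on
  \<open>v\<close>. By \<open>sum_q\<close> its values on the base vertices then sum to 0, and being
  nonnegative they all vanish.\<close>

lemma zero_in_interior: "0 \<in> interior (convex hull V)"
proof (rule zero_in_interiorI)
  have V: "v \<in> convex hull V" "- v \<in> convex hull V" "q1 \<in> convex hull V" "q2 \<in> convex hull V" "q3 \<in> convex hull V"
    by (simp_all add: V_def hull_inc)
  show "0 \<in> convex hull V"
    using convexD[OF convex_convex_hull V(1,2), of "1/2" "1/2"] by simp
  fix a assume a: "\<And>x. x \<in> convex hull V \<Longrightarrow> 0 \<le> a \<bullet> x"
  have av: "a \<bullet> v = 0" using a[OF V(1)] a[OF V(2)] by simp
  have "a \<bullet> q1 + a \<bullet> q2 + a \<bullet> q3 = 0"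
    using arg_cong[OF sum_q, of "\<lambda>x. a \<bullet> x"] av by (simp add: inner_add_right)
  then have "a \<bullet> q1 = 0" "a \<bullet> q2 = 0"
    using a[OF V(3)] a[OF V(4)] a[OF V(5)] by linarith+
  then show "a = 0"
    using av s by (intro spanning) (simp_all add: q1_def q2_def inner_add_right)
qed simp

lemma aff_dim_hull: "aff_dim (convex hull V) = 3"
  using aff_dim_nonempty_interior[of "convex hull V"] zero_in_interior by auto

text \<open>By \<open>sum_q\<close>, value 1 on all of \<open>q1\<close>, \<open>q2\<close>,
  \<open>q3\<close> and absolute value 1 on \<open>v\<close> would give 3 = 3 c or 3 = -3 c,
  contradicting -1 < c < 1. So no supporting plane contains an apex together with the whole base,
  nor can it contain both apices.\<close>

lemma functional_cases:
  assumes n: "\<forall>x\<in>V. n \<bullet> x \<le> 1" and T: "T = {x \<in> V. n \<bullet> x = 1}"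
  shows "v \<in> T \<Longrightarrow> T \<in> {{v}, {v, q1}, {v, q2}, {v, q3}, {v, q1, q2}, {v, q2, q3}, {v, q3, q1}}"
    and "card T \<le> 3"
proof -
  have nV: "n \<bullet> v \<le> 1" "- (n \<bullet> v) \<le> 1" "n \<bullet> q1 \<le> 1" "n \<bullet> q2 \<le> 1" "n \<bullet> q3 \<le> 1"
    using n by (auto simp: V_def)
  have sum: "n \<bullet> q1 + n \<bullet> q2 + n \<bullet> q3 = 3 * c * (n \<bullet> v)"
    using arg_cong[OF sum_q, of "\<lambda>x. n \<bullet> x"] by (simp add: inner_add_right)
  have T': "T = (if n \<bullet> v = 1 then {v} else {}) \<union> (if n \<bullet> v = - 1 then {- v} else {})
      \<union> (if n \<bullet> q1 = 1 then {q1} else {}) \<union> (if n \<bullet> q2 = 1 then {q2} else {}) \<union> (if n \<bullet> q3 = 1 then {q3} else {})"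
    unfolding T V_def by auto
  have not_all: "\<not> (n \<bullet> q1 = 1 \<and> n \<bullet> q2 = 1 \<and> n \<bullet> q3 = 1)" if "\<bar>n \<bullet> v\<bar> = 1"
  proof -
    have "n \<bullet> v = 1 \<or> n \<bullet> v = - 1" using that by linarith
    then show ?thesis using sum c_bounds by auto
  qed
  show "T \<in> {{v}, {v, q1}, {v, q2}, {v, q3}, {v, q1, q2}, {v, q2, q3}, {v, q3, q1}}" if "v \<in> T"
  proof -
    have "n \<bullet> v = 1" using that by (simp add: T)
    then show ?thesis using not_all unfolding T' by auto
  qed
  show "card T \<le> 3"
    using not_all unfolding T' by (auto simp: card_insert_if)
qed

text \<open>The coefficient is chosen so that \<open>facet_normal e3\<close> takes the value 1 on \<open>v\<close>, \<open>q1\<close> and \<open>q2\<close>.\<close>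

definition facet_normal :: "real^3 \<Rightarrow> real^3" where
  "facet_normal e = v - (2 * (1 - c) / s) *\<^sub>R e"

lemma facet_normal_inner [simp]:
  "facet_normal e1 \<bullet> v = 1" "facet_normal e2 \<bullet> v = 1" "facet_normal e3 \<bullet> v = 1"
  "facet_normal e1 \<bullet> q1 = 3 * c - 2" "facet_normal e1 \<bullet> q2 = 1" "facet_normal e1 \<bullet> q3 = 1"
  "facet_normal e2 \<bullet> q1 = 1" "facet_normal e2 \<bullet> q2 = 3 * c - 2" "facet_normal e2 \<bullet> q3 = 1"
  "facet_normal e3 \<bullet> q1 = 1" "facet_normal e3 \<bullet> q2 = 1" "facet_normal e3 \<bullet> q3 = 3 * c - 2"
  using s by (simp_all add: facet_normal_def inner_diff_left field_simps)

lemma independent_facet: "\<not> affine_dependent {v, q1, q2}"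
  by (rule affine_independent_3I[where l = v and x = c and m = "facet_normal e1" and y = 1 and n = "facet_normal e2" and z = 1])
     (use c_bounds in auto)

lemma aff_dim_facet: "aff_dim {v, q1, q2} = 2"
proof -
  have "card {v, q1, q2} = 3"
    using distinct_V(1,2,7) by (auto simp: card_insert_if)
  then show ?thesis
    using aff_dim_affine_independent[OF independent_facet] by simp
qed

lemma facet: "convex hull {v, q1, q2} facet_of convex hull V"
proof -
  \<comment> \<open>On the two remaining vertices the values are -1 at \<open>- v\<close> and 3 c -
    2 < 1 at \<open>q3\<close>.\<close>
  have eq: "{x \<in> V. facet_normal e3 \<bullet> x = 1} = {v, q1, q2}"
    using c_bounds by (auto simp: V_def)
  have "\<forall>x\<in>V. facet_normal e3 \<bullet> x \<le> 1"
    using c_bounds by (auto simp: V_def)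
  then have "convex hull {v, q1, q2} face_of convex hull V"
    using face_of_convex_hull_functional[OF finite_V, of "facet_normal e3"] unfolding eq by blast
  then show ?thesis
    using aff_dim_hull by (simp add: facet_of_def aff_dim_convex_hull aff_dim_facet)
qed

lemma edge: "convex hull {v, q1} edge_of convex hull V"
proof -
  have "convex hull {v, q1} face_of convex hull {v, q1, q2}"
    unfolding face_of_convex_hull_affine_independent[OF independent_facet]
    by (intro exI[of _ "{v, q1}"]) auto
  also have "\<dots> face_of convex hull V"
    using facet by (rule facet_of_imp_face_of)
  finally show ?thesis
    using distinct_V by (simp add: edge_of_def aff_dim_convex_hull)
qed

lemma rotated_vertices:
  "bipyramid.q1 v e2 s c = q2" "bipyramid.q2 v e3 s c = q3" "bipyramid.q3 v e1 s c = q1"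
  "bipyramid.V v e2 e3 e1 s c = V"
proof -
  interpret R: bipyramid v e2 e3 e1 s c by (rule rotate)
  show q: "R.q1 = q2" "R.q2 = q3" "R.q3 = q1"
    by (simp_all add: R.q1_def R.q2_def R.q3_def q1_def q2_def q3_def)
  show "R.V = V"
    unfolding R.V_def V_def q by blast
qed

text \<open>Two cyclic relabellings carry the facet and the edge already treated to the others at
  \<open>v\<close>.\<close>

lemma facets_edges:
  "convex hull {v, q1, q2} facet_of convex hull V" "convex hull {v, q2, q3} facet_of convex hull V" "convex hull {v, q3, q1} facet_of convex hull V"
  "convex hull {v, q1} edge_of convex hull V" "convex hull {v, q2} edge_of convex hull V" "convex hull {v, q3} edge_of convex hull V"
  "aff_dim {v, q1, q2} = 2" "aff_dim {v, q2, q3} = 2" "aff_dim {v, q3, q1} = 2"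
proof -
  interpret R: bipyramid v e2 e3 e1 s c by (rule rotate)
  interpret R2: bipyramid v e3 e1 e2 s c by (rule R.rotate)
  note eq = rotated_vertices R.rotated_vertices[unfolded rotated_vertices]
  show "convex hull {v, q1, q2} facet_of convex hull V" "convex hull {v, q1} edge_of convex hull V" "aff_dim {v, q1, q2} = 2"
    by (rule facet edge aff_dim_facet)+
  show "convex hull {v, q2, q3} facet_of convex hull V" "convex hull {v, q2} edge_of convex hull V" "aff_dim {v, q2, q3} = 2"
    using R.facet R.edge R.aff_dim_facet unfolding eq by simp_all
  show "convex hull {v, q3, q1} facet_of convex hull V" "convex hull {v, q3} edge_of convex hull V" "aff_dim {v, q3, q1} = 2"
    using R2.facet R2.edge R2.aff_dim_facet unfolding eq by simp_all
qed

text \<open>Dimension 2 needs at least three vertices and \<open>functional_cases\<close> allows at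
  most three, so every facet is a triangle, whether or not it contains \<open>v\<close>.\<close>

lemma facet_cases:
  assumes "F facet_of convex hull V"
  obtains T where "F = convex hull T" "aff_dim T = 2" "card T = 3" "finite T"
    "v \<in> F \<longrightarrow> T \<in> {{v, q1, q2}, {v, q2, q3}, {v, q3, q1}}"
proof -
  have F: "F face_of convex hull V" "F \<noteq> {}" "F \<noteq> convex hull V" and dim: "aff_dim F = 2"
    using assms aff_dim_hull by (auto simp: facet_of_def)
  obtain n where n: "\<forall>x\<in>V. n \<bullet> x \<le> 1" "F = convex hull {x \<in> V. n \<bullet> x = 1}" "F \<subseteq> {x. n \<bullet> x = 1}"
    using finite_V zero_in_interior F by (rule proper_face_convex_hull_functional)
  define T where "T = {x \<in> V. n \<bullet> x = 1}"
  have T: "finite T" "aff_dim T = 2"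
    using dim finite_V n(2) by (simp_all add: T_def aff_dim_convex_hull)
  have "card T = 3"
    using aff_dim_le_card[OF T(1)] T(2) functional_cases(2)[OF n(1) T_def] by simp
  moreover have "T \<in> {{v, q1, q2}, {v, q2, q3}, {v, q3, q1}}" if "v \<in> F"
  proof -
    have "v \<in> T" using that n(3) by (auto simp: T_def V_def)
    from functional_cases(1)[OF n(1) T_def this] \<open>card T = 3\<close> show ?thesis
      by (auto simp: card_insert_if split: if_splits)
  qed
  ultimately show thesis
    using n(2) T by (intro that[of T]) (simp_all add: T_def)
qed

text \<open>In the list of \<open>functional_cases\<close>, dimension 1 excludes the singleton and,
  by \<open>facets_edges\<close>, the triples.\<close>

lemma edge_cases:
  assumes "e edge_of convex hull V" "v \<in> e"
  shows "e \<in> {convex hull {v, q1}, convex hull {v, q2}, convex hull {v, q3}}"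
proof -
  have e: "e face_of convex hull V" "e \<noteq> {}" "e \<noteq> convex hull V" and dim: "aff_dim e = 1"
    using assms aff_dim_hull by (auto simp: edge_of_def)
  obtain n where n: "\<forall>x\<in>V. n \<bullet> x \<le> 1" "e = convex hull {x \<in> V. n \<bullet> x = 1}" "e \<subseteq> {x. n \<bullet> x = 1}"
    using finite_V zero_in_interior e by (rule proper_face_convex_hull_functional)
  define T where "T = {x \<in> V. n \<bullet> x = 1}"
  have "aff_dim T = 1"
    using dim n(2) by (simp add: T_def aff_dim_convex_hull)
  moreover have "v \<in> T" using assms(2) n(3) by (auto simp: T_def V_def)
  from functional_cases(1)[OF n(1) T_def this] have "T \<in> {{v}, {v, q1}, {v, q2}, {v, q3}, {v, q1, q2}, {v, q2, q3}, {v, q3, q1}}" .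
  ultimately have "T \<in> {{v, q1}, {v, q2}, {v, q3}}"
    using facets_edges(7-9) by auto
  then show ?thesis using n(2) by (auto simp: T_def)
qed

lemma degree3_star_bipyramid:
  assumes p: "p 1 = q1" "p 2 = q2" "p 3 = q3"
  shows "degree3_star v p"
proof -
  let ?P = "convex hull V"
  have v_in: "v \<in> convex hull {v, x}" "v \<in> convex hull {v, x, y}" for x y
    by (simp_all add: hull_inc)
  have simplicial: "simplicial_polytope3 ?P"
    unfolding simplicial_polytope3_def
  proof (intro conjI allI impI)
    show "polytope ?P" using finite_V by (auto simp: polytope_def)
    show "aff_dim ?P = 3" by (rule aff_dim_hull)
    fix F assume "F facet_of ?P"
    then obtain T where T: "F = convex hull T" "aff_dim T = 2" "card T = 3" "finite T"
      by (rule facet_cases)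
    then have "\<not> affine_dependent T"
      by (simp add: affine_independent_iff_card)
    with T show "2 simplex F"
      unfolding simplex_def by (intro exI[of _ T]) simp
  qed
  have facets: "{F. F facet_of ?P \<and> v \<in> F} = {convex hull {v, q1, q2}, convex hull {v, q2, q3}, convex hull {v, q3, q1}}"
  proof (intro equalityI subsetI)
    fix F assume "F \<in> {F. F facet_of ?P \<and> v \<in> F}"
    then have F: "F facet_of ?P" "v \<in> F" by auto
    from F(1) obtain T where "F = convex hull T" "v \<in> F \<longrightarrow> T \<in> {{v, q1, q2}, {v, q2, q3}, {v, q3, q1}}"
      by (rule facet_cases)
    then show "F \<in> {convex hull {v, q1, q2}, convex hull {v, q2, q3}, convex hull {v, q3, q1}}"
      using F(2) by auto
  qed (use facets_edges v_in in auto)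
  have edges: "{e. e edge_of ?P \<and> v \<in> e} = {convex hull {v, q1}, convex hull {v, q2}, convex hull {v, q3}}"
    using edge_cases facets_edges v_in by auto
  \<comment> \<open>A segment from \<open>v\<close> determines its other end; this gives both the
    count of three edges and the set of neighbours.\<close>
  have seg_eq: "convex hull {v, x} = convex hull {v, y} \<longleftrightarrow> x = y" for x y
    by (simp flip: segment_convex_hull) (auto simp: doubleton_eq_iff)
  have "card {convex hull {v, q1}, convex hull {v, q2}, convex hull {v, q3}} = 3"
    using distinct_V(7-9) by (simp add: seg_eq card_insert_if)
  then have degree: "vertex_degree ?P v = 3"
    by (simp only: vertex_degree_def edges)
  have nbrs: "polytope_neighbors ?P v = {q1, q2, q3}"
  proof -
    have "closed_segment v x edge_of ?P \<longleftrightarrow> x \<in> {q1, q2, q3}" for x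
    proof -
      have "closed_segment v x edge_of ?P \<longleftrightarrow> convex hull {v, x} \<in> {e. e edge_of ?P \<and> v \<in> e}"
        using v_in by (simp add: segment_convex_hull)
      then show ?thesis unfolding edges by (simp add: seg_eq)
    qed
    then show ?thesis by (auto simp: polytope_neighbors_def)
  qed
  \<comment> \<open>The functional \<open>v\<close> exposes the vertex \<open>v\<close>: it is -1 at
    \<open>- v\<close> and c < 1 on the base.\<close>
  have eq: "{x \<in> V. v \<bullet> x = 1} = {v}"
    using c_bounds by (auto simp: V_def)
  have "\<forall>x\<in>V. v \<bullet> x \<le> 1"
    using c_bounds by (auto simp: V_def)
  then have "convex hull {v} face_of ?P"
    using face_of_convex_hull_functional[OF finite_V, of v] unfolding eq by blast
  then have "v extreme_point_of ?P"
    by (simp add: face_of_singleton)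
  moreover have "\<forall>x. x extreme_point_of ?P \<longrightarrow> x \<in> sphere 0 1"
    using norm_V extreme_point_of_convex_hull by auto
  ultimately show ?thesis
    unfolding degree3_star_def p
    using simplicial zero_in_interior degree nbrs facets by blast
qed

end

lemma rotationally_symmetric_cyclic_azimuths:
  assumes "rotationally_symmetric v p" and v: "norm v = 1" and "p 4 = p 1"
  obtains u w \<theta> where "orthonormal_frame v u w"
    "orthonormal_frame.cyclic_azimuths v u w p (\<lambda>_. \<theta>) (\<lambda>i. real i * (2 * pi / 3))" "degree3_star v p"
proof -
  obtain \<theta> u w where \<theta>: "0 < \<theta>" "\<theta> < pi" and F: "norm u = 1" "norm w = 1" "u \<bullet> w = 0" "v \<bullet> u = 0" "v \<bullet> w = 0"
    and p: "\<forall>i\<in>{1..3}. p i = spherical_point v u w \<theta> (real i * (2 * pi / 3))"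
    using assms(1) unfolding rotationally_symmetric_def by blast
  interpret orthonormal_frame v u w
    using F v by unfold_locales
  have p123: "p 1 = spherical_point v u w \<theta> (2 * pi / 3)" "p 2 = spherical_point v u w \<theta> (4 * pi / 3)"
    "p 3 = spherical_point v u w \<theta> (2 * pi)"
    using p[rule_format, of 1] p[rule_format, of 2] p[rule_format, of 3] by simp_all
  \<comment> \<open>The symmetry hypothesis covers indices 1 to 3; azimuth 8 pi / 3 is that of
    \<open>p 1\<close> plus a full turn.\<close>
  have p4: "p 4 = spherical_point v u w \<theta> (real 4 * (2 * pi / 3))"
  proof -
    have "real 4 * (2 * pi / 3) = 2 * pi / 3 + 2 * pi" by simp
    then show ?thesis
      unfolding assms(3) p123 spherical_point_def by (simp only: sin_periodic cos_periodic)
  qed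
  have "{1..4} = insert 4 {1..3::nat}" by auto
  then have cyc: "cyclic_azimuths p (\<lambda>_. \<theta>) (\<lambda>i. real i * (2 * pi / 3))"
    using \<theta> p p4 unfolding cyclic_azimuths_def by (auto simp: field_simps)
  have trig: "cos (4 * pi / 3) = - (1 / 2)" "sin (4 * pi / 3) = - (sqrt 3 / 2)" "cos (2 * pi / 3) = - (1 / 2)" "sin (2 * pi / 3) = sqrt 3 / 2"
  proof -
    have "4 * pi / 3 = pi / 3 + pi" by simp
    then show "cos (4 * pi / 3) = - (1 / 2)" "sin (4 * pi / 3) = - (sqrt 3 / 2)"
      by (simp_all only: cos_periodic_pi sin_periodic_pi cos_60 sin_60)
  qed (simp_all add: cos_120 sin_120)
  \<comment> \<open>The directions of azimuth 2 pi / 3 and 4 pi / 3; the third direction, of azimuth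
    2 pi, is \<open>u\<close> itself.\<close>
  define e1 e2 where "e1 = - (1 / 2) *\<^sub>R u + (sqrt 3 / 2) *\<^sub>R w" and "e2 = - (1 / 2) *\<^sub>R u - (sqrt 3 / 2) *\<^sub>R w"
  interpret B: bipyramid v e1 e2 u "sin \<theta>" "cos \<theta>"
  proof
    show "a = 0" if a: "a \<bullet> v = 0" "a \<bullet> e1 = 0" "a \<bullet> e2 = 0" for a
    proof -
      obtain x where x: "a = frame_map x" using surj_frame_map by blast
      have "- (1 / 2) * (a \<bullet> u) + sqrt 3 / 2 * (a \<bullet> w) = 0" "- (1 / 2) * (a \<bullet> u) - sqrt 3 / 2 * (a \<bullet> w) = 0"
        using a(2,3) by (simp_all add: e1_def e2_def inner_diff_right inner_add_right)
      then have "a \<bullet> u = 0" "sqrt 3 * (a \<bullet> w) = 0"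
        by linarith+
      then have "a \<bullet> u = 0" "a \<bullet> w = 0"
        by simp_all
      then have "x $ 1 = 0" "x $ 2 = 0" "x $ 3 = 0"
        using a(1) by (simp_all add: x inner_frame_map inner_commute)
      then show ?thesis by (simp add: x frame_map_def)
    qed
    show "e1 + e2 + u = 0"
      unfolding e1_def e2_def by (simp add: algebra_simps flip: scaleR_add_left)
  qed (use \<theta> in \<open>simp_all add: e1_def e2_def inner_add_left inner_add_right inner_diff_left inner_diff_right sin_gt_zero\<close>)
  have "p 1 = B.q1" "p 2 = B.q2" "p 3 = B.q3"
    unfolding p123 spherical_point_def B.q1_def B.q2_def B.q3_def trig
    unfolding e1_def e2_def
    by (simp_all add: scaleR_add_right scaleR_diff_right)
  then have "degree3_star v p"
    by (rule B.degree3_star_bipyramid)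
  with orthonormal_frame_axioms cyc show thesis by (rule that)
qed

theorem lemma3p9:
  fixes v0 :: "real^3" and p :: "nat \<Rightarrow> real^3" and \<alpha> :: real
  assumes "v0 \<in> sphere 0 1"
    and "p 1 \<in> sphere 0 1" and "p 2 \<in> sphere 0 1" and "p 3 \<in> sphere 0 1"
    and "p 4 = p 1"
    and "\<alpha> = (\<Sum>i=1..3. sphere_area (spherical_triangle v0 (p i) (p (i + 1))))"
  shows "(degree3_star v0 p \<longrightarrow>
            (\<Sum>i=1..3. measure lebesgue (convex hull {0, v0, p i, p (i + 1)}))
              \<le> sqrt 3 / 4 * (1 - 1 / 3 * (tan ((2 * pi - \<alpha>) / 6))\<^sup>2))
       \<and> (rotationally_symmetric v0 p \<longrightarrow>
            degree3_star v0 p \<and>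
            (\<Sum>i=1..3. measure lebesgue (convex hull {0, v0, p i, p (i + 1)}))
              = sqrt 3 / 4 * (1 - 1 / 3 * (tan ((2 * pi - \<alpha>) / 6))\<^sup>2))"
proof (intro conjI impI)
  have unit: "norm v0 = 1" "norm (p 1) = 1" "norm (p 2) = 1" "norm (p 3) = 1"
    using assms(1-4) by simp_all
  show "(\<Sum>i=1..3. measure lebesgue (convex hull {0, v0, p i, p (i + 1)}))
          \<le> sqrt 3 / 4 * (1 - 1 / 3 * (tan ((2 * pi - \<alpha>) / 6))\<^sup>2)" if "degree3_star v0 p"
    using degree3_star_cyclic_azimuths[OF that unit assms(5)] orthonormal_frame.cyclic_azimuths_volume_le[OF _ _ assms(6)]
    by metis
  show "degree3_star v0 p" if "rotationally_symmetric v0 p"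
    using rotationally_symmetric_cyclic_azimuths[OF that unit(1) assms(5)] by metis
  show "(\<Sum>i=1..3. measure lebesgue (convex hull {0, v0, p i, p (i + 1)}))
          = sqrt 3 / 4 * (1 - 1 / 3 * (tan ((2 * pi - \<alpha>) / 6))\<^sup>2)" if "rotationally_symmetric v0 p"
    using rotationally_symmetric_cyclic_azimuths[OF that unit(1) assms(5)] orthonormal_frame.cyclic_azimuths_volume_eq[OF _ _ assms(6)]
    by metis
qed

end
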